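(* Consider the following online pricing problem, with all objects as specified in the context. A utility faces $N$ users with unknown cost parameters $\alpha_i,\beta_i$ ($1\le i\le N$) over time slots $t=1,\dots,T$. In slot $t$ it posts a price $\lambda_t$ chosen by an online policy, and it then observes the noisy responses $\hat x_i^t(\lambda_t)=\frac{N\lambda_t-\alpha_i}{\beta_i}+\epsilon_i^t$. Let $R_t=\mathbb{E}\{C(\hat{\boldsymbol{x}}_t(\lambda_t),Y^* )\}-\mathbb{E}\{C(\hat{\boldsymbol{x}}_t(\lambda_t^* ),Y^* )\}$ be the gap in slot $t$ between the cost of the online strategy and the cost of the optimal offline solution, and let $R=\sum_{t=1}^T R_t$ be the regret. Then there exists an online policy (algorithm) for which the gap $R_t$ decays as $1/t$, i.e. $R_t=O(1/t)$, and which achieves $\log T$-regret, i.e. $R=O(\log T)$.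
   Context: **Setting.** A utility coordinates $N$ users over time slots $t=1,\dots,T$. At the beginning of slot $t$ a normalized demand-reduction target $d_t$ is revealed to the utility. User $i$ has the quadratic cost $u_i(x)=\frac12\beta_i x^2+\alpha_i x$, with $\alpha_i,\beta_i$ unknown to the utility. Given price $\lambda$, user $i$ minimizes $\frac{u_i(x)}{N}-\lambda x$ over $x$, so the intended response is $x_i^t(\lambda)=\frac{N\lambda-\alpha_i}{\beta_i}$. The actual observed response is $$\hat x_i^t(\lambda)=\frac{N\lambda-\alpha_i}{\beta_i}+\epsilon_i^t,$$ where the noises $\epsilon_i^t$ are independent standard Gaussian (mean $0$, variance $1$) over all $i$ and $t$. Write $\hat{\boldsymbol{x}}_t(\lambda)=(\hat x_1^t(\lambda),\dots,\hat x_N^t(\lambda))$. **Cost.** For capacity $Y$, the cost in slot $t$ is $$C(\hat{\boldsymbol{x}}_t,Y)=\frac1N\sum_{i=1}^N\left(\tfrac12\beta_i(\hat x_i^t)^2+\alpha_i\hat x_i^t\right)+\frac{1}{2N}\left(\sum_{i=1}^N\hat x_i^t-Yd_t\right)^2 .$$ **Capacity.** The capacity is determined before the horizon and treated as known to the utility. It is fixed at the optimal value $$Y^*=\frac{T\alpha\left(1+\sum_i\frac1{\beta_i}\right)^2-\sum_t\left(\sum_i\frac{\alpha_i}{\beta_i}\right)\left(1+\sum_i\frac1{\beta_i}\right)d_t}{\sum_t d_t^2\left(1+\sum_i\frac1{\beta_i}\right)},$$ where $\alpha$ is the unit revenue of the utility per slot and unit capacity. **Offline optimum.** With full knowledge of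 $\alpha_i,\beta_i$, the optimal price in slot $t$ is $$\lambda_t^*=\frac{Y^*d_t+\sum_{i=1}^N\frac{\alpha_i}{\beta_i}}{N+\sum_{i=1}^N\frac{N}{\beta_i}} .$$ **Online policy.** A rule that determines $\lambda_t$ from the past history $\mathcal H_t=\{\lambda_s,\hat x_i^s(\lambda_s):1\le i\le N,\ 1\le s\le t-1\}$, together with $Y^*$ and the current target $d_t$, without knowledge of the parameters $\alpha_i,\beta_i$. Expectations are over the noise and any randomness it induces in $\lambda_t$. **Standing assumptions.** The $\beta_i$ are positive. The $\alpha_i,\beta_i$ are finite and bounded away from zero (the case where all $\alpha_i=0$ is also covered). The revenue $\alpha$ is bounded below away from zero. The targets $d_t$ are bounded away from zero and are randomly spread over an interval $[d_{\min},d_{\max}]$, so that they are not the same across time. In this regime $Y^*=\Theta(N)$. **Asymptotic notation.** $f(n)=O(g(n))$ means there are positive constants $k,n_0$ with $f(n)\le k\,g(n)$ for all $n\ge n_0$. $f(n)=\Theta(g(n))$ means there are positive constants $k_1,k_2,n_0$ with $0\le k_1g(n)\le f(n)\le k_2g(n)$ for all $n\ge n_0$. *)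

theory Defs
  imports "HOL-Probability.Probability"
begin

text \<open>Users are indexed by \<open>{1..N}\<close> and time slots by \<open>{1..T}\<close>.\<close>

record dr_problem =
  users :: nat
  horizon :: nat
  alpha :: "nat \<Rightarrow> real"
  beta :: "nat \<Rightarrow> real"
  revenue :: real
  target :: "nat \<Rightarrow> real"

definition sum_inv_beta :: "dr_problem \<Rightarrow> real" where
  "sum_inv_beta P = (\<Sum>i=1..users P. 1 / beta P i)"

definition sum_alpha_beta :: "dr_problem \<Rightarrow> real" where
  "sum_alpha_beta P = (\<Sum>i=1..users P. alpha P i / beta P i)"

definition opt_capacity :: "dr_problem \<Rightarrow> real" where
  "opt_capacity P =
     (real (horizon P) * revenue P * (1 + sum_inv_beta P)\<^sup>2
        - (\<Sum>t=1..horizon P. sum_alpha_beta P * (1 + sum_inv_beta P) * target P t))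
     / (\<Sum>t=1..horizon P. (target P t)\<^sup>2 * (1 + sum_inv_beta P))"

definition opt_price :: "dr_problem \<Rightarrow> nat \<Rightarrow> real" where
  "opt_price P t = (opt_capacity P * target P t + sum_alpha_beta P)
     / (real (users P) + (\<Sum>i=1..users P. real (users P) / beta P i))"

text \<open>In the next definition \<open>e\<close> is the vector of noises of the users in one slot.\<close>

definition noisy_response :: "dr_problem \<Rightarrow> (nat \<Rightarrow> real) \<Rightarrow> real \<Rightarrow> nat \<Rightarrow> real" where
  "noisy_response P e lam i = (real (users P) * lam - alpha P i) / beta P i + e i"

definition slot_cost :: "dr_problem \<Rightarrow> real \<Rightarrow> nat \<Rightarrow> (nat \<Rightarrow> real) \<Rightarrow> real" where
  "slot_cost P Y t x =
     1 / real (users P) * (\<Sum>i=1..users P. 1 / 2 * beta P i * (x i)\<^sup>2 + alpha P i * x i)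
     + 1 / (2 * real (users P)) * ((\<Sum>i=1..users P. x i) - Y * target P t)\<^sup>2"

text \<open>
  A history lists, in chronological order, the posted price and the responses of users
  \<open>1, \<dots>, N\<close> in every past slot. A policy maps the number of users, the history, the capacity
  and the current target to a price. The unknown parameters, the revenue, the horizon and the
  future targets are not available to it, and the index of the current slot is one more than the
  length of the history.
\<close>

type_synonym history = "(real \<times> real list) list"
type_synonym policy = "nat \<Rightarrow> history \<Rightarrow> real \<Rightarrow> real \<Rightarrow> real"

text \<open>
  The history after \<open>t\<close> slots when \<open>\<pi>\<close> is used and the noise of user \<open>i\<close> in slot \<open>t\<close> takes the
  value \<open>e i t\<close>.
\<close>

primrec online_history :: "policy \<Rightarrow> dr_problem \<Rightarrow> (nat \<Rightarrow> nat \<Rightarrow> real) \<Rightarrow> nat \<Rightarrow> history" where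
  "online_history \<pi> P e 0 = []"
| "online_history \<pi> P e (Suc t) =
     (let h = online_history \<pi> P e t;
          lam = \<pi> (users P) h (opt_capacity P) (target P (Suc t))
      in h @ [(lam, map (noisy_response P (\<lambda>i. e i (Suc t)) lam) [1..<Suc (users P)])])"

definition online_price :: "policy \<Rightarrow> dr_problem \<Rightarrow> (nat \<Rightarrow> nat \<Rightarrow> real) \<Rightarrow> nat \<Rightarrow> real" where
  "online_price \<pi> P e t =
     \<pi> (users P) (online_history \<pi> P e (t - 1)) (opt_capacity P) (target P t)"

definition gaussian_noise ::
  "'w measure \<Rightarrow> dr_problem \<Rightarrow> (nat \<Rightarrow> nat \<Rightarrow> 'w \<Rightarrow> real) \<Rightarrow> bool" where
  "gaussian_noise M P \<epsilon> \<longleftrightarrow>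
     prob_space M \<and>
     prob_space.indep_vars M (\<lambda>_. borel) (\<lambda>(i, t). \<epsilon> i t) ({1..users P} \<times> {1..horizon P}) \<and>
     (\<forall>i\<in>{1..users P}. \<forall>t\<in>{1..horizon P}.
        distributed M lborel (\<epsilon> i t) (\<lambda>x. ennreal (std_normal_density x)))"

definition online_cost ::
  "policy \<Rightarrow> dr_problem \<Rightarrow> (nat \<Rightarrow> nat \<Rightarrow> 'w \<Rightarrow> real) \<Rightarrow> nat \<Rightarrow> 'w \<Rightarrow> real" where
  "online_cost \<pi> P \<epsilon> t \<omega> =
     slot_cost P (opt_capacity P) t
       (noisy_response P (\<lambda>i. \<epsilon> i t \<omega>) (online_price \<pi> P (\<lambda>i s. \<epsilon> i s \<omega>) t))"

definition offline_cost ::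
  "dr_problem \<Rightarrow> (nat \<Rightarrow> nat \<Rightarrow> 'w \<Rightarrow> real) \<Rightarrow> nat \<Rightarrow> 'w \<Rightarrow> real" where
  "offline_cost P \<epsilon> t \<omega> =
     slot_cost P (opt_capacity P) t (noisy_response P (\<lambda>i. \<epsilon> i t \<omega>) (opt_price P t))"

definition gap ::
  "'w measure \<Rightarrow> policy \<Rightarrow> dr_problem \<Rightarrow> (nat \<Rightarrow> nat \<Rightarrow> 'w \<Rightarrow> real) \<Rightarrow> nat \<Rightarrow> real" where
  "gap M \<pi> P \<epsilon> t =
     (\<integral>\<omega>. online_cost \<pi> P \<epsilon> t \<omega> \<partial>M) - (\<integral>\<omega>. offline_cost P \<epsilon> t \<omega> \<partial>M)"

definition regret ::
  "'w measure \<Rightarrow> policy \<Rightarrow> dr_problem \<Rightarrow> (nat \<Rightarrow> nat \<Rightarrow> 'w \<Rightarrow> real) \<Rightarrow> real" where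
  "regret M \<pi> P \<epsilon> = (\<Sum>t=1..horizon P. gap M \<pi> P \<epsilon> t)"

text \<open>
  The constants behind the phrases ``bounded'', ``bounded away from zero'' and
  ``\<open>Y\<^sup>* = \<Theta>(N)\<close>'' in the standing assumptions.
\<close>

record regime =
  alpha_lo :: real
  alpha_hi :: real
  beta_lo :: real
  beta_hi :: real
  revenue_lo :: real
  target_lo :: real
  target_hi :: real
  spread :: real
  spread_from :: nat
  capacity_lo :: real
  capacity_hi :: real

definition valid_regime :: "regime \<Rightarrow> bool" where
  "valid_regime B \<longleftrightarrow>
     0 < alpha_lo B \<and> alpha_lo B \<le> alpha_hi B \<and>
     0 < beta_lo B \<and> beta_lo B \<le> beta_hi B \<and>
     0 < revenue_lo B \<and>
     0 < target_lo B \<and> target_lo B < target_hi B \<and>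
     0 < spread B \<and> 0 < spread_from B \<and>
     0 < capacity_lo B \<and> capacity_lo B \<le> capacity_hi B"

definition empirical_mean :: "(nat \<Rightarrow> real) \<Rightarrow> nat \<Rightarrow> real" where
  "empirical_mean d t = (\<Sum>s=1..t. d s) / real t"

definition empirical_variance :: "(nat \<Rightarrow> real) \<Rightarrow> nat \<Rightarrow> real" where
  "empirical_variance d t = (\<Sum>s=1..t. (d s - empirical_mean d t)\<^sup>2) / real t"

text \<open>
  Expectations are taken over the noise only, so the targets enter as a fixed realisation. That
  they are spread over an interval and do not settle at one value is expressed by a lower bound
  on the empirical variance of the targets seen so far; almost every realisation of a
  nondegenerate i.i.d. sequence satisfies such a bound from some slot on.

  A lower bound on the revenue alone does not exclude a capacity close to or below zero, hence
  \<open>Y\<^sup>* = \<Theta>(N)\<close> is listed as well.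
\<close>

definition standing_assumptions :: "regime \<Rightarrow> dr_problem \<Rightarrow> bool" where
  "standing_assumptions B P \<longleftrightarrow>
     ((\<forall>i\<in>{1..users P}. alpha_lo B \<le> \<bar>alpha P i\<bar> \<and> \<bar>alpha P i\<bar> \<le> alpha_hi B) \<or>
      (\<forall>i\<in>{1..users P}. alpha P i = 0)) \<and>
     (\<forall>i\<in>{1..users P}. beta_lo B \<le> beta P i \<and> beta P i \<le> beta_hi B) \<and>
     revenue_lo B \<le> revenue P \<and>
     (\<forall>t\<in>{1..horizon P}. target_lo B \<le> target P t \<and> target P t \<le> target_hi B) \<and>
     (\<forall>t\<in>{spread_from B..horizon P}. spread B \<le> empirical_variance (target P) t) \<and>
     capacity_lo B * real (users P) \<le> opt_capacity P \<and>
     opt_capacity P \<le> capacity_hi B * real (users P)"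

end

theory Submission imports Defs
begin

text \<open>
  The optimal price is affine in the target, \<open>\<lambda>\<^sup>*\<^sub>t = A d\<^sub>t + C\<close>. The residual
  \<open>N \<lambda>\<^sub>t + \<Sum>\<^sub>i x\<^sub>i - Y d\<^sub>t\<close> is observable and equals \<open>G (\<lambda>\<^sub>t - \<lambda>\<^sup>*\<^sub>t) + z\<^sub>t\<close> with
  \<open>G = N (1 + \<Sum>\<^sub>i 1/\<beta>\<^sub>i) \<ge> N\<close> and \<open>z\<^sub>t\<close> the sum of the noises. The policy estimates \<open>(A, C)\<close> by a
  stochastic Newton recursion driven by this residual, whose preconditioner
  \<open>M\<^sub>t = I + (\<Sum>s\<le>t. s \<phi>\<^sub>s \<phi>\<^sub>s\<^sup>T)\<close>, \<open>\<phi>\<^sub>s = (d\<^sub>s, 1)\<close>, depends on the targets only and not on the noise.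
  Take \<open>e\<^sup>T M\<^sub>t e\<close>, for the estimation error \<open>e\<close>, as a Lyapunov function. A step size of at least
  \<open>2 / G\<close> makes its drift nonpositive once \<open>t\<close> is large, and each slot contributes \<open>O(1)\<close> through the
  noise, so its mean is \<open>O(t)\<close>. The variance of the targets gives \<open>M\<^sub>t \<ge> c t\<^sup>2 I\<close>, and the mean square
  error is \<open>O(1/t)\<close>. Equal weights instead of the weights \<open>s\<close> would lose a factor \<open>log t\<close> in this argument.
  Finally, the gap is \<open>N/2 b (1 + b) E (\<lambda>\<^sub>t - \<lambda>\<^sup>*\<^sub>t)\<^sup>2\<close> with \<open>b = \<Sum>\<^sub>i 1/\<beta>\<^sub>i\<close>, since the noise of slot \<open>t\<close> is
  independent of \<open>\<lambda>\<^sub>t\<close>.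
\<close>

section \<open>Weighted normal equations\<close>

text \<open>
  With \<open>\<phi>\<^sub>s = (d s, 1)\<close> and \<open>M\<^sub>t = I + (\<Sum>s\<le>t. s \<phi>\<^sub>s \<phi>\<^sub>s\<^sup>T)\<close>, \<open>qform d t x y = (x, y) M\<^sub>t (x, y)\<^sup>T\<close>; further down,
  \<open>(gain1 d t, gain2 d t) = M\<^sub>t\<^sup>-\<^sup>1 \<phi>\<^sub>t\<close> and \<open>leverage d t = \<phi>\<^sub>t\<^sup>T M\<^sub>t\<^sup>-\<^sup>1 \<phi>\<^sub>t\<close>.
\<close>

definition wmom :: "(nat \<Rightarrow> real) \<Rightarrow> nat \<Rightarrow> nat \<Rightarrow> real" where
  "wmom d j t = (\<Sum>s=1..t. real s * d s ^ j)"

definition qform :: "(nat \<Rightarrow> real) \<Rightarrow> nat \<Rightarrow> real \<Rightarrow> real \<Rightarrow> real" where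
  "qform d t x y = x\<^sup>2 + y\<^sup>2 + (\<Sum>s=1..t. real s * (x * d s + y)\<^sup>2)"

lemma qform_eq_wmom:
  "qform d t x y = (1 + wmom d 2 t) * x\<^sup>2 + 2 * wmom d 1 t * x * y + (1 + wmom d 0 t) * y\<^sup>2"
proof -
  have "(\<Sum>s=1..t. real s * (x * d s + y)\<^sup>2)
      = (\<Sum>s=1..t. real s * d s ^ 2 * x\<^sup>2 + real s * d s ^ 1 * (2 * x * y) + real s * d s ^ 0 * y\<^sup>2)"
    by (intro sum.cong refl) (simp add: power2_eq_square algebra_simps)
  also have "\<dots> = wmom d 2 t * x\<^sup>2 + wmom d 1 t * (2 * x * y) + wmom d 0 t * y\<^sup>2"
    by (simp only: wmom_def sum.distrib sum_distrib_right)
  finally show ?thesis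
    by (simp add: qform_def algebra_simps)
qed

lemma qform_Suc: "qform d (Suc t) x y = qform d t x y + real (Suc t) * (x * d (Suc t) + y)\<^sup>2"
  by (simp add: qform_def)

lemma qform_ge_norm: "x\<^sup>2 + y\<^sup>2 \<le> qform d t x y"
  by (auto simp: qform_def intro!: sum_nonneg)

definition wdet :: "(nat \<Rightarrow> real) \<Rightarrow> nat \<Rightarrow> real" where
  "wdet d t = (1 + wmom d 2 t) * (1 + wmom d 0 t) - (wmom d 1 t)\<^sup>2"

text \<open>\<open>wdet d t\<close> is the determinant of \<open>M\<^sub>t\<close>. Up to the factor
  \<open>1 + wmom d 0 t\<close> it is the value of the form at the vector
  \<open>(1 + wmom d 0 t, - wmom d 1 t)\<close>, and the identity summand of
  \<open>M\<^sub>t\<close> makes the form positive there.\<close>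

lemma wdet_pos: "0 < wdet d t"
proof -
  have m: "0 \<le> wmom d 0 t"
    by (auto simp: wmom_def intro!: sum_nonneg)
  have "0 < (1 + wmom d 0 t)\<^sup>2 + (- wmom d 1 t)\<^sup>2"
    using m by (intro add_pos_nonneg) auto
  also have "\<dots> \<le> qform d t (1 + wmom d 0 t) (- wmom d 1 t)"
    by (rule qform_ge_norm)
  also have "\<dots> = (1 + wmom d 0 t) * wdet d t"
    by (simp add: qform_eq_wmom wdet_def power2_eq_square algebra_simps)
  finally show ?thesis
    using m by (simp add: zero_less_mult_iff)
qed

definition gain1 :: "(nat \<Rightarrow> real) \<Rightarrow> nat \<Rightarrow> real" where
  "gain1 d t = ((1 + wmom d 0 t) * d t - wmom d 1 t) / wdet d t"

definition gain2 :: "(nat \<Rightarrow> real) \<Rightarrow> nat \<Rightarrow> real" where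
  "gain2 d t = (1 + wmom d 2 t - wmom d 1 t * d t) / wdet d t"

text \<open>Cramer's rule for the symmetric 2 x 2 system with matrix \<open>M\<^sub>t\<close> and
  right-hand side \<open>(d t, 1)\<close>. The identities for the quadratic form below rest on these
  two equations.\<close>

lemma gain_normal_eqs:
  "(1 + wmom d 2 t) * gain1 d t + wmom d 1 t * gain2 d t = d t"
  "wmom d 1 t * gain1 d t + (1 + wmom d 0 t) * gain2 d t = 1"
proof -
  define u v w where "u = 1 + wmom d 2 t" and "v = wmom d 1 t" and "w = 1 + wmom d 0 t"
  have D: "wdet d t = u * w - v\<^sup>2" "wdet d t \<noteq> 0"
    using wdet_pos[of d t] by (simp_all add: wdet_def u_def v_def w_def)
  have "u * gain1 d t + v * gain2 d t = (u * (w * d t - v) + v * (u - v * d t)) / wdet d t"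
    by (simp add: gain1_def gain2_def u_def v_def w_def add_divide_distrib)
  also have "u * (w * d t - v) + v * (u - v * d t) = d t * wdet d t"
    unfolding D(1) by (simp add: power2_eq_square algebra_simps)
  finally show "(1 + wmom d 2 t) * gain1 d t + wmom d 1 t * gain2 d t = d t"
    using D(2) by (simp add: u_def v_def)
  have "v * gain1 d t + w * gain2 d t = (v * (w * d t - v) + w * (u - v * d t)) / wdet d t"
    by (simp add: gain1_def gain2_def u_def v_def w_def add_divide_distrib)
  also have "v * (w * d t - v) + w * (u - v * d t) = wdet d t"
    unfolding D(1) by (simp add: power2_eq_square algebra_simps)
  finally show "wmom d 1 t * gain1 d t + (1 + wmom d 0 t) * gain2 d t = 1"
    using D(2) by (simp add: v_def w_def)
qed

definition leverage :: "(nat \<Rightarrow> real) \<Rightarrow> nat \<Rightarrow> real" where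
  "leverage d t = d t * gain1 d t + gain2 d t"

text \<open>The preconditioner cancels in the cross term: \<open>M\<^sub>t\<close> applied to the
  gain vector is \<open>(d t, 1)\<close>, so a correction along the gains changes the form only
  through the prediction \<open>x * d t + y\<close> and the leverage.\<close>

lemma qform_update:
  "qform d t (x - k * gain1 d t) (y - k * gain2 d t)
     = qform d t x y - 2 * k * (x * d t + y) + k\<^sup>2 * leverage d t"
proof -
  have *: "u * (x - k * p)\<^sup>2 + 2 * v * (x - k * p) * (y - k * q) + w * (y - k * q)\<^sup>2
      = (u * x\<^sup>2 + 2 * v * x * y + w * y\<^sup>2) - 2 * k * (x * (u * p + v * q) + y * (v * p + w * q))
        + k\<^sup>2 * ((u * p + v * q) * p + (v * p + w * q) * q)" for u v w p q :: real
    by (simp add: power2_eq_square algebra_simps)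
  show ?thesis
    unfolding qform_eq_wmom * gain_normal_eqs leverage_def by (simp add: mult.commute)
qed

lemma leverage_eq_qform: "leverage d t = qform d t (gain1 d t) (gain2 d t)"
proof -
  have *: "u * p\<^sup>2 + 2 * v * p * q + w * q\<^sup>2 = (u * p + v * q) * p + (v * p + w * q) * q"
    for u v w p q :: real
    by (simp add: power2_eq_square algebra_simps)
  show ?thesis
    unfolding qform_eq_wmom * gain_normal_eqs leverage_def by simp
qed

lemma leverage_nonneg: "0 \<le> leverage d t"
  unfolding leverage_eq_qform by (rule order_trans[OF _ qform_ge_norm]) simp

lemma linear_form_sq_le: "(x * a + y)\<^sup>2 \<le> (1 + a\<^sup>2) * (x\<^sup>2 + y\<^sup>2)" for x y a :: real
proof -
  have "(1 + a\<^sup>2) * (x\<^sup>2 + y\<^sup>2) - (x * a + y)\<^sup>2 = (x - y * a)\<^sup>2"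
    by (simp add: power2_eq_square algebra_simps)
  then show ?thesis
    by (metis diff_ge_0_iff_ge zero_le_power2)
qed

text \<open>A self-bounding argument: the leverage is at once the linear form and the quadratic form
  at the gain vector. Cauchy-Schwarz and the lower bound \<mu> therefore dominate its square by a
  multiple of itself, and one factor cancels.\<close>

lemma leverage_le:
  assumes "0 < \<mu>" and "\<And>x y. \<mu> * (x\<^sup>2 + y\<^sup>2) \<le> qform d t x y"
  shows "leverage d t \<le> (1 + (d t)\<^sup>2) / \<mu>"
proof (cases "leverage d t = 0")
  case False
  then have pos: "0 < leverage d t"
    using leverage_nonneg[of d t] by simp
  have "\<mu> * (leverage d t)\<^sup>2 \<le> \<mu> * ((1 + (d t)\<^sup>2) * ((gain1 d t)\<^sup>2 + (gain2 d t)\<^sup>2))"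
    using linear_form_sq_le[of "gain1 d t" "d t" "gain2 d t"] assms(1)
    by (intro mult_left_mono) (simp_all add: leverage_def mult.commute)
  also have "\<dots> = (1 + (d t)\<^sup>2) * (\<mu> * ((gain1 d t)\<^sup>2 + (gain2 d t)\<^sup>2))"
    by simp
  also have "\<dots> \<le> (1 + (d t)\<^sup>2) * leverage d t"
    unfolding leverage_eq_qform by (intro mult_left_mono assms(2)) simp
  finally have "\<mu> * leverage d t \<le> 1 + (d t)\<^sup>2"
    using pos by (simp add: power2_eq_square mult.assoc[symmetric])
  then show ?thesis
    using assms(1) by (simp add: field_simps)
qed (use assms(1) in \<open>simp add: add_nonneg_nonneg\<close>)

section \<open>Quadratic growth of the form under spread targets\<close>

text \<open>For a given total S the weighted sum is smallest when the mass sits as early as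
  possible, at height \<open>b\<close> on about S / b slots, which yields about S^2 / (2 b). Linear
  growth of plain sums thus becomes quadratic growth of weighted ones.\<close>

lemma square_sum_le_weighted_sum:
  fixes q :: "nat \<Rightarrow> real"
  assumes "\<And>s. s \<in> {1..t} \<Longrightarrow> 0 \<le> q s \<and> q s \<le> b" and "0 \<le> b"
  shows "(\<Sum>s=1..t. q s)\<^sup>2 \<le> 2 * b * (\<Sum>s=1..t. real s * q s)"
  using assms(1)
proof (induction t)
  case (Suc t)
  have le: "(\<Sum>s=1..t. q s) \<le> real t * b"
    using sum_bounded_above[of "{1..t}" q b] Suc.prems by simp
  have q: "0 \<le> q (Suc t)" "q (Suc t) \<le> b" "q (Suc t) \<le> 2 * b"
    using Suc.prems[of "Suc t"] \<open>0 \<le> b\<close> by auto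
  have "(\<Sum>s=1..Suc t. q s)\<^sup>2 = (\<Sum>s=1..t. q s)\<^sup>2 + q (Suc t) * (2 * (\<Sum>s=1..t. q s) + q (Suc t))"
    by (simp add: power2_eq_square algebra_simps)
  also have "\<dots> \<le> 2 * b * (\<Sum>s=1..t. real s * q s) + q (Suc t) * (2 * (real t * b) + 2 * b)"
    using Suc.prems le q by (intro add_mono mult_left_mono Suc.IH) auto
  also have "\<dots> = 2 * b * (\<Sum>s=1..Suc t. real s * q s)"
    by (simp add: algebra_simps)
  finally show ?case .
qed simp

text \<open>Centring at the empirical mean: the mixed term vanishes because deviations from the mean
  sum to zero.\<close>

lemma sum_linear_form_sq:
  assumes "0 < t"
  shows "(\<Sum>s=1..t. (x * d s + y)\<^sup>2)
    = real t * (x\<^sup>2 * empirical_variance d t + (x * empirical_mean d t + y)\<^sup>2)"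
proof -
  define m where "m = empirical_mean d t"
  have m: "(\<Sum>s=1..t. d s) = real t * m"
    using assms by (simp add: m_def empirical_mean_def)
  have v: "(\<Sum>s=1..t. (d s - m)\<^sup>2) = real t * empirical_variance d t"
    using assms by (simp add: m_def empirical_variance_def)
  have "(\<Sum>s=1..t. (x * d s + y)\<^sup>2)
      = (\<Sum>s=1..t. x\<^sup>2 * (d s - m)\<^sup>2 + 2 * x * (x * m + y) * (d s - m) + (x * m + y)\<^sup>2)"
    by (intro sum.cong refl) (simp add: power2_eq_square algebra_simps)
  also have "\<dots> = x\<^sup>2 * (\<Sum>s=1..t. (d s - m)\<^sup>2) + 2 * x * (x * m + y) * (\<Sum>s=1..t. d s - m)
      + real t * (x * m + y)\<^sup>2"
    by (simp add: sum.distrib sum_distrib_left)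
  also have "(\<Sum>s=1..t. d s - m) = 0"
    using m by (simp add: sum_subtractf)
  finally show ?thesis
    unfolding v by (simp add: m_def algebra_simps)
qed

lemma abs_empirical_mean_le:
  assumes "\<And>s. s \<in> {1..t} \<Longrightarrow> \<bar>d s\<bar> \<le> D" and "0 < t"
  shows "\<bar>empirical_mean d t\<bar> \<le> D"
proof -
  have "\<bar>\<Sum>s=1..t. d s\<bar> \<le> (\<Sum>s=1..t. \<bar>d s\<bar>)"
    by (rule sum_abs)
  also have "\<dots> \<le> real t * D"
    using sum_bounded_above[of "{1..t}" "\<lambda>s. \<bar>d s\<bar>" D] assms(1) by simp
  finally show ?thesis
    using assms(2) by (simp add: empirical_mean_def field_simps)
qed

text \<open>The constant \<mu> in \<open>M\<^sub>t\<close> \<ge> \<mu> (t + 1)^2 I. The first entry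
  of the outer minimum covers the slots before \<open>t0\<close>, where only the identity in
  \<open>M\<^sub>t\<close> is available; the second comes from the variance bound.\<close>

definition excitation :: "real \<Rightarrow> real \<Rightarrow> nat \<Rightarrow> real" where
  "excitation D \<sigma> t0 =
     min (1 / (real t0)\<^sup>2) ((min (\<sigma> / (1 + 2 * D\<^sup>2)) (1 / 2))\<^sup>2 / (8 * (1 + D\<^sup>2)))"

lemma excitation_pos: "0 < \<sigma> \<Longrightarrow> 0 < t0 \<Longrightarrow> 0 < excitation D \<sigma> t0"
  by (auto simp: excitation_def add_pos_nonneg zero_less_divide_iff min_def)

lemma qform_ge_excitation:
  assumes d: "\<And>s. s \<in> {1..t} \<Longrightarrow> \<bar>d s\<bar> \<le> D"
    and var: "t0 \<le> t \<Longrightarrow> \<sigma> \<le> empirical_variance d t"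
    and t0: "0 < t0" and \<sigma>: "0 < \<sigma>"
  shows "excitation D \<sigma> t0 * (real (Suc t))\<^sup>2 * (x\<^sup>2 + y\<^sup>2) \<le> qform d t x y"
proof (cases "t < t0 \<or> x\<^sup>2 + y\<^sup>2 = 0")
  case True
  have "excitation D \<sigma> t0 * (real (Suc t))\<^sup>2 * (x\<^sup>2 + y\<^sup>2) \<le> x\<^sup>2 + y\<^sup>2"
  proof (cases "x\<^sup>2 + y\<^sup>2 = 0")
    case False
    with True have "t < t0"
      by blast
    then have "real (Suc t) \<le> real t0"
      by (simp only: of_nat_le_iff Suc_le_eq)
    then have "(real (Suc t))\<^sup>2 \<le> (real t0)\<^sup>2"
      by (intro power_mono) auto
    moreover have "excitation D \<sigma> t0 \<le> 1 / (real t0)\<^sup>2"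
      by (simp add: excitation_def)
    ultimately have "excitation D \<sigma> t0 * (real (Suc t))\<^sup>2 \<le> 1 / (real t0)\<^sup>2 * (real t0)\<^sup>2"
      using excitation_pos[OF \<sigma> t0, of D] by (intro mult_mono) auto
    then have "excitation D \<sigma> t0 * (real (Suc t))\<^sup>2 \<le> 1"
      using t0 by simp
    then show ?thesis
      using mult_right_mono[of _ 1 "x\<^sup>2 + y\<^sup>2"] by simp
  qed simp
  then show ?thesis
    using qform_ge_norm order_trans by blast
next
  case False
  define e where "e = x\<^sup>2 + y\<^sup>2"
  \<comment> \<open>The two bounds on \<open>c\<close> match the two coefficients of the centred
    decomposition: \<open>c * (1 + 2 * D\<^sup>2)\<close> must not exceed the variance, and
    \<open>2 * c\<close> must not exceed 1.\<close>
  define c where "c = min (\<sigma> / (1 + 2 * D\<^sup>2)) (1 / 2)"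
  define S where "S = (\<Sum>s=1..t. (x * d s + y)\<^sup>2)"
  define m where "m = empirical_mean d t"
  have e: "0 < e"
    using False by (simp add: e_def sum_power2_gt_zero_iff) 
  have t: "0 < t" "t0 \<le> t"
    using False t0 by auto
  have c: "0 < c" "c \<le> 1 / 2" "c * (1 + 2 * D\<^sup>2) \<le> \<sigma>"
  proof -
    have p: "0 < 1 + 2 * D\<^sup>2"
      by (simp add: add_pos_nonneg)
    then show "0 < c"
      using \<sigma> by (simp add: c_def)
    show "c \<le> 1 / 2"
      unfolding c_def by (rule min.cobounded2)
    have "c \<le> \<sigma> / (1 + 2 * D\<^sup>2)"
      by (simp add: c_def)
    then show "c * (1 + 2 * D\<^sup>2) \<le> \<sigma>"
      using p by (simp add: field_simps)
  qed
  have m: "m\<^sup>2 \<le> D\<^sup>2"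
    using abs_empirical_mean_le[of t d D] d t(1) by (simp add: m_def power2_le_iff_abs_le abs_le_square_iff[symmetric])
  have ye: "y\<^sup>2 \<le> 2 * (x * m + y)\<^sup>2 + 2 * D\<^sup>2 * x\<^sup>2"
  proof -
    have "0 \<le> (2 * x * m + y)\<^sup>2"
      by simp
    then have "y\<^sup>2 \<le> 2 * (x * m + y)\<^sup>2 + 2 * m\<^sup>2 * x\<^sup>2"
      by (simp add: power2_eq_square algebra_simps)
    also have "2 * m\<^sup>2 * x\<^sup>2 \<le> 2 * D\<^sup>2 * x\<^sup>2"
      using m by (intro mult_right_mono) auto
    finally show ?thesis by simp
  qed
  have "c * e \<le> c * ((1 + 2 * D\<^sup>2) * x\<^sup>2 + 2 * (x * m + y)\<^sup>2)"
    using c(1) ye by (intro mult_left_mono) (simp_all add: e_def algebra_simps)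
  also have "\<dots> = c * (1 + 2 * D\<^sup>2) * x\<^sup>2 + (2 * c) * (x * m + y)\<^sup>2"
    by (simp add: algebra_simps)
  also have "\<dots> \<le> empirical_variance d t * x\<^sup>2 + 1 * (x * m + y)\<^sup>2"
    using c var[OF t(2)] by (intro add_mono mult_right_mono) auto
  finally have "real t * (c * e) \<le> S"
    unfolding S_def sum_linear_form_sq[OF t(1)] m_def
    by (intro mult_left_mono) (simp_all add: mult.commute)
  then have "(real t * (c * e))\<^sup>2 \<le> S\<^sup>2"
    using c(1) e by (intro power_mono) auto
  also have "\<dots> \<le> 2 * ((1 + D\<^sup>2) * e) * (\<Sum>s=1..t. real s * (x * d s + y)\<^sup>2)"
    unfolding S_def
  proof (rule square_sum_le_weighted_sum)
    fix s assume "s \<in> {1..t}"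
    then have "(d s)\<^sup>2 \<le> D\<^sup>2"
      using d[of s] by (simp add: abs_le_square_iff[symmetric])
    then have "(1 + (d s)\<^sup>2) * e \<le> (1 + D\<^sup>2) * e"
      using e by (intro mult_right_mono) auto
    then show "0 \<le> (x * d s + y)\<^sup>2 \<and> (x * d s + y)\<^sup>2 \<le> (1 + D\<^sup>2) * e"
      using linear_form_sq_le[of x "d s" y] by (simp add: e_def)
  qed (use e in simp)
  also have "\<dots> \<le> 2 * ((1 + D\<^sup>2) * e) * qform d t x y"
    using e by (intro mult_left_mono) (auto simp: qform_def)
  \<comment> \<open>Squaring produces \<open>e\<close> twice; the uniform bound on the summands is
    itself proportional to \<open>e\<close>, so one factor cancels and the estimate is homogeneous
    again.\<close>
  finally have "(c\<^sup>2 * (real t)\<^sup>2 * e) * e \<le> (2 * (1 + D\<^sup>2) * qform d t x y) * e"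
    by (simp add: power2_eq_square algebra_simps)
  then have *: "c\<^sup>2 * (real t)\<^sup>2 * e \<le> 2 * (1 + D\<^sup>2) * qform d t x y"
    using e by simp
  have p: "0 < 1 + D\<^sup>2"
    by (simp add: add_pos_nonneg)
  \<comment> \<open>The 8 in \<open>excitation\<close> is 2 * 4: the 2 stems from the weighted-sum
    inequality, the 4 pays for replacing \<open>t\<close> by \<open>Suc t\<close>, at most
    \<open>2 * t\<close>.\<close>
  have "excitation D \<sigma> t0 * (real (Suc t))\<^sup>2 \<le> c\<^sup>2 / (8 * (1 + D\<^sup>2)) * (4 * (real t)\<^sup>2)"
  proof (intro mult_mono)
    show "excitation D \<sigma> t0 \<le> c\<^sup>2 / (8 * (1 + D\<^sup>2))"
      by (simp add: excitation_def c_def)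
    have "(real (Suc t))\<^sup>2 \<le> (2 * real t)\<^sup>2"
      using t(1) by (intro power_mono) auto
    then show "(real (Suc t))\<^sup>2 \<le> 4 * (real t)\<^sup>2"
      by (simp add: power_mult_distrib)
  qed auto
  also have "\<dots> = c\<^sup>2 * (real t)\<^sup>2 / (2 * (1 + D\<^sup>2))"
    using p by (simp add: field_simps)
  finally have "excitation D \<sigma> t0 * (real (Suc t))\<^sup>2 * e \<le> c\<^sup>2 * (real t)\<^sup>2 / (2 * (1 + D\<^sup>2)) * e"
    using e by (intro mult_right_mono) auto
  also have "\<dots> \<le> qform d t x y"
    using * p by (simp add: divide_le_eq mult.commute mult.left_commute)
  finally show ?thesis
    by (simp add: e_def)
qed

section \<open>The estimation recursion\<close>

text \<open>
  The history does not contain the past targets. A price whose slope in the target is nonzero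
  reveals the target, so the estimated slope \<open>a\<close> is moved away from zero before it is used; the
  perturbation of order \<open>1 / t\<close> does not affect the rate.
\<close>

definition safe_slope :: "nat \<Rightarrow> real \<Rightarrow> real" where
  "safe_slope t a = (if 1 / real t \<le> \<bar>a\<bar> then a else 1 / real t)"

lemma safe_slope_nonzero: "0 < t \<Longrightarrow> safe_slope t a \<noteq> 0"
  by (auto simp: safe_slope_def)

lemma abs_safe_slope_diff_le: "0 < t \<Longrightarrow> \<bar>safe_slope t a - a\<bar> \<le> 2 / real t"
proof -
  assume t: "0 < t"
  then have "0 < 1 / real t"
    by simp
  show ?thesis
  proof (cases "1 / real t \<le> \<bar>a\<bar>")
    case False
    have "\<bar>1 / real t - a\<bar> \<le> 1 / real t + \<bar>a\<bar>"
      using \<open>0 < 1 / real t\<close> by linarith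
    also have "\<dots> \<le> 1 / real t + 1 / real t"
      using False by simp
    finally show ?thesis
      using False by (simp add: safe_slope_def)
  qed (simp add: safe_slope_def)
qed

lemma fst_snd_borel [measurable]:
  "fst \<in> borel_measurable (borel :: (real \<times> real) measure)"
  "snd \<in> borel_measurable (borel :: (real \<times> real) measure)"
  by (auto intro!: borel_measurable_continuous_onI continuous_intros)

lemma safe_slope_measurable [measurable]: "safe_slope t \<in> borel_measurable borel"
  unfolding safe_slope_def [abs_def] by measurable

text \<open>
  The estimates as a function of the aggregate noise \<open>z\<close> and of the unknown truth: \<open>A d + C\<close> is the
  optimal price for the target \<open>d\<close>, and \<open>G\<close> is the unknown slope of the residual.
\<close>

primrec est :: "(nat \<Rightarrow> real) \<Rightarrow> real \<Rightarrow> real \<Rightarrow> real \<Rightarrow> real \<Rightarrow> (nat \<Rightarrow> real) \<Rightarrow> nat \<Rightarrow> real \<times> real" where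
  "est d g G A C z 0 = (0, 0)"
| "est d g G A C z (Suc t) =
     (let (a, c) = est d g G A C z t;
          k = real (Suc t) * g *
            (G * (safe_slope (Suc t) a * d (Suc t) + c - (A * d (Suc t) + C)) + z (Suc t))
      in (a - k * gain1 d (Suc t), c - k * gain2 d (Suc t)))"

text \<open>The recursion is adapted: the estimate after \<open>t\<close> slots sees only the noise
  of those slots. Its independence of the next noise rests on this.\<close>

lemma est_cong:
  "(\<And>s. s \<in> {1..t} \<Longrightarrow> z s = z' s) \<Longrightarrow> est d g G A C z t = est d g G A C z' t"
  by (induction t) simp_all

lemma est_measurable:
  assumes "t \<le> n"
  shows "(\<lambda>z. est d g G A C z t) \<in> borel_measurable (Pi\<^sub>M {1..n} (\<lambda>_. borel))"
  using assms
proof (induction t)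
  case (Suc t)
  have e: "(\<lambda>z. est d g G A C z t) \<in> borel_measurable (Pi\<^sub>M {1..n} (\<lambda>_. borel))"
    using Suc by (simp only: Suc_leD)
  have [measurable]: "(\<lambda>z. z (Suc t)) \<in> borel_measurable (Pi\<^sub>M {1..n} (\<lambda>_. borel :: real measure))"
    using Suc.prems by (intro measurable_component_singleton) auto
  have [measurable]: "(\<lambda>z. fst (est d g G A C z t)) \<in> borel_measurable (Pi\<^sub>M {1..n} (\<lambda>_. borel))"
    "(\<lambda>z. snd (est d g G A C z t)) \<in> borel_measurable (Pi\<^sub>M {1..n} (\<lambda>_. borel))"
    by (rule measurable_compose[OF e fst_snd_borel(1)] measurable_compose[OF e fst_snd_borel(2)])+
  show ?case
    unfolding est.simps Let_def case_prod_beta' by measurable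
qed simp

section \<open>Square-integrable random variables\<close>

definition sq_integrable :: "'w measure \<Rightarrow> ('w \<Rightarrow> real) \<Rightarrow> bool" where
  "sq_integrable M f \<longleftrightarrow> f \<in> borel_measurable M \<and> integrable M (\<lambda>\<omega>. (f \<omega>)\<^sup>2)"

lemma sq_integrable_measurable: "sq_integrable M f \<Longrightarrow> f \<in> borel_measurable M"
  by (simp add: sq_integrable_def)

lemma sq_integrable_cmult:
  "sq_integrable M f \<Longrightarrow> sq_integrable M (\<lambda>\<omega>. c * f \<omega>)"
  by (auto simp: sq_integrable_def power_mult_distrib)

lemma sq_integrable_add:
  assumes "sq_integrable M f" "sq_integrable M h"
  shows "sq_integrable M (\<lambda>\<omega>. f \<omega> + h \<omega>)"
proof -
  have [measurable]: "f \<in> borel_measurable M" "h \<in> borel_measurable M"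
    using assms by (simp_all add: sq_integrable_def)
  have "integrable M (\<lambda>\<omega>. 2 * (f \<omega>)\<^sup>2 + 2 * (h \<omega>)\<^sup>2)"
    using assms by (simp add: sq_integrable_def)
  then have "integrable M (\<lambda>\<omega>. (f \<omega> + h \<omega>)\<^sup>2)"
  proof (rule Bochner_Integration.integrable_bound)
    have "(f \<omega> + h \<omega>)\<^sup>2 \<le> 2 * (f \<omega>)\<^sup>2 + 2 * (h \<omega>)\<^sup>2" for \<omega>
      using zero_le_power2[of "f \<omega> - h \<omega>"] by (simp add: power2_eq_square algebra_simps)
    then show "AE \<omega> in M. norm ((f \<omega> + h \<omega>)\<^sup>2) \<le> norm (2 * (f \<omega>)\<^sup>2 + 2 * (h \<omega>)\<^sup>2)"
      by simp
  qed measurable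
  then show ?thesis
    by (simp add: sq_integrable_def)
qed

lemma sq_integrable_diff:
  assumes "sq_integrable M f" "sq_integrable M h"
  shows "sq_integrable M (\<lambda>\<omega>. f \<omega> - h \<omega>)"
  using sq_integrable_add[OF assms(1) sq_integrable_cmult[OF assms(2), of "- 1"]] by simp

lemma sq_integrable_sum:
  "(\<And>i. i \<in> I \<Longrightarrow> sq_integrable M (f i)) \<Longrightarrow> sq_integrable M (\<lambda>\<omega>. \<Sum>i\<in>I. f i \<omega>)"
proof (induction I rule: infinite_finite_induct)
  case (insert i I)
  then show ?case
    by (simp add: sq_integrable_add)
qed (simp_all add: sq_integrable_def)

text \<open>Polarization: the product is a quarter of the difference of two integrable
  squares.\<close>

lemma integrable_mult_of_sq_integrable:
  assumes "sq_integrable M f" "sq_integrable M h"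
  shows "integrable M (\<lambda>\<omega>. f \<omega> * h \<omega>)"
proof -
  have "integrable M (\<lambda>\<omega>. ((f \<omega> + h \<omega>)\<^sup>2 - (f \<omega> - h \<omega>)\<^sup>2) / 4)"
    using sq_integrable_add[OF assms] sq_integrable_diff[OF assms] by (simp add: sq_integrable_def)
  then show ?thesis
    by (simp add: power2_eq_square algebra_simps)
qed

lemma (in prob_space) sq_integrable_bounded:
  assumes "f \<in> borel_measurable M" "\<And>\<omega>. \<bar>f \<omega>\<bar> \<le> b"
  shows "sq_integrable M f"
  unfolding sq_integrable_def
proof
  show "integrable M (\<lambda>\<omega>. (f \<omega>)\<^sup>2)"
  proof (rule integrable_const_bound)
    show "AE \<omega> in M. norm ((f \<omega>)\<^sup>2) \<le> b\<^sup>2"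
      using power_mono[OF assms(2), where n = 2] by simp
  qed (use assms(1) in measurable)
qed fact

text \<open>
  The quadratic part of the one-step change of the Lyapunov function. For \<open>w \<ge> 4 R H\<close> the second
  order term is dominated by the descent term, so that no multiple of \<open>q\<^sup>2\<close> remains.
\<close>

lemma drift_le:
  fixes q p w h \<rho> R H b :: real
  assumes w: "1 \<le> w" and h: "0 \<le> h" "w\<^sup>2 * h \<le> H" and \<rho>: "2 \<le> \<rho>" "\<rho> \<le> R"
    and p: "w\<^sup>2 * p\<^sup>2 \<le> b"
  shows "w * q\<^sup>2 - 2 * w * \<rho> * (q * (q + p)) + w\<^sup>2 * h * (\<rho> * (q + p))\<^sup>2
    \<le> (if w < 4 * R * H then 4 * R * H + 2 * H * R\<^sup>2 else 0) * q\<^sup>2 + (2 * R * b + 2 * H * R\<^sup>2 * b)"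
    (is "?L \<le> ?R")
proof -
  have H: "0 \<le> H"
    using h w by (meson mult_nonneg_nonneg order_trans zero_le_power2)
  have qp: "(q + p)\<^sup>2 \<le> 2 * q\<^sup>2 + 2 * p\<^sup>2"
    using zero_le_power2[of "q - p"] by (simp add: power2_eq_square algebra_simps)
  have wp: "w * p\<^sup>2 \<le> b"
  proof -
    have "w * p\<^sup>2 \<le> w\<^sup>2 * p\<^sup>2"
      using w by (intro mult_right_mono) (simp_all add: power2_eq_square)
    then show ?thesis
      using p by simp
  qed
  have pb: "p\<^sup>2 \<le> b"
    using wp w mult_right_mono[of 1 w "p\<^sup>2"] by simp
  have b: "0 \<le> b"
    using pb zero_le_power2[of p] by linarith
  have Rb: "\<rho> * (w * p\<^sup>2) \<le> R * b"
    using \<rho> wp w by (intro mult_mono) auto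
  have Rb0: "0 \<le> R * b"
    using b \<rho> by simp
  show ?thesis
  proof (cases "w < 4 * R * H")
    case True
    have "w\<^sup>2 * h * (\<rho> * (q + p))\<^sup>2 \<le> H * (R\<^sup>2 * (2 * q\<^sup>2 + 2 * p\<^sup>2))"
      unfolding power_mult_distrib using h H qp \<rho> by (intro mult_mono power_mono) auto
    also have "\<dots> = 2 * H * R\<^sup>2 * q\<^sup>2 + 2 * H * R\<^sup>2 * p\<^sup>2"
      by (simp add: algebra_simps)
    also have "\<dots> \<le> 2 * H * R\<^sup>2 * q\<^sup>2 + 2 * H * R\<^sup>2 * b"
      using H pb by (intro add_left_mono mult_left_mono) auto
    finally have 1: "w\<^sup>2 * h * (\<rho> * (q + p))\<^sup>2 \<le> 2 * H * R\<^sup>2 * q\<^sup>2 + 2 * H * R\<^sup>2 * b" .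
    have "- 2 * (q * (q + p)) \<le> p\<^sup>2 / 2"
      using zero_le_power2[of "2 * q + p"] by (simp add: power2_eq_square algebra_simps)
    then have "w * \<rho> * (- 2 * (q * (q + p))) \<le> w * \<rho> * (p\<^sup>2 / 2)"
      using w \<rho> by (intro mult_left_mono) auto
    also have "\<dots> \<le> R * b"
      using Rb Rb0 by (simp add: algebra_simps)
    finally have 2: "- 2 * w * \<rho> * (q * (q + p)) \<le> R * b"
      by (simp add: algebra_simps)
    have 3: "w * q\<^sup>2 \<le> 4 * R * H * q\<^sup>2"
      using True by (intro mult_right_mono) auto
    show ?thesis
      using 1 2 3 Rb0 True by (simp add: algebra_simps)
  next
    case False
    \<comment> \<open>From \<rho> \<le> R and 4 R H \<le> w it follows that \<rho> w h \<le> R H / w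
      \<le> 1/4, so the second-order term is a fixed fraction of the descent term.\<close>
    have "w * (w * h) \<le> H"
      using h by (simp add: power2_eq_square mult.assoc)
    then have "w * (\<rho> * (w * h)) \<le> \<rho> * H"
      using \<rho> mult_left_mono[of "w * (w * h)" H \<rho>] by (simp add: mult.left_commute)
    also have "\<dots> \<le> w * (1 / 4)"
      using False mult_right_mono[OF \<rho>(2) H] by simp
    finally have "\<rho> * (w * h) \<le> 1 / 4"
      using w by (subst (asm) mult_le_cancel_left_pos) auto
    then have "(w * \<rho>) * (\<rho> * (w * h)) * (q + p)\<^sup>2 \<le> (w * \<rho>) * (1 / 4) * (2 * q\<^sup>2 + 2 * p\<^sup>2)"
      using w \<rho> h qp by (intro mult_mono mult_left_mono) auto
    then have 1: "w\<^sup>2 * h * (\<rho> * (q + p))\<^sup>2 \<le> w * \<rho> * ((q\<^sup>2 + p\<^sup>2) / 2)"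
      by (simp add: power2_eq_square algebra_simps)
    have 2: "w * q\<^sup>2 \<le> w * \<rho> * (q\<^sup>2 / 2)"
      using mult_right_mono[OF \<rho>(1), of "w * q\<^sup>2"] w by (simp add: algebra_simps)
    \<comment> \<open>The coefficients of q^2 are 1/2 from the new weight (using \<rho> \<ge> 2), -2
      from the descent and 1/2 from the second-order term. The remaining -1 absorbs the mixed term
      -2 q p and leaves only a multiple of p^2.\<close>
    have "?L \<le> w * \<rho> * (q\<^sup>2 / 2) - w * \<rho> * (2 * (q * (q + p))) + w * \<rho> * ((q\<^sup>2 + p\<^sup>2) / 2)"
      using 1 2 by (simp add: mult.assoc mult.left_commute)
    also have "\<dots> = w * \<rho> * (q\<^sup>2 / 2 - 2 * (q * (q + p)) + (q\<^sup>2 + p\<^sup>2) / 2)"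
      by (simp only: distrib_left right_diff_distrib)
    also have "\<dots> \<le> w * \<rho> * (2 * p\<^sup>2)"
    proof (intro mult_left_mono)
      have "q\<^sup>2 / 2 - 2 * (q * (q + p)) + (q\<^sup>2 + p\<^sup>2) / 2 = 2 * p\<^sup>2 - (q + p)\<^sup>2 - p\<^sup>2 / 2"
        by (simp add: power2_eq_square field_simps)
      then show "q\<^sup>2 / 2 - 2 * (q * (q + p)) + (q\<^sup>2 + p\<^sup>2) / 2 \<le> 2 * p\<^sup>2"
        using zero_le_power2[of "q + p"] zero_le_power2[of p] by linarith
    qed (use w \<rho> in auto)
    also have "\<dots> \<le> 2 * R * b"
      using Rb by (simp add: algebra_simps)
    also have "\<dots> \<le> ?R"
      using False H b by simp
    finally show ?thesis .
  qed
qed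

section \<open>Mean square error of the posted price\<close>

text \<open>The condition 2 \<le> g G is the step-size requirement, and \<open>R\<close> replaces
  \<open>g * G\<close> in all later constants, so that these depend on bounds and not on the unknown
  \<open>G\<close>, \<open>A\<close>, \<open>C\<close>. Since \<open>est\<close> starts at
  \<open>(0, 0)\<close>, \<open>init\<close> bounds the initial squared error.\<close>

locale adaptive_pricing = prob_space M for M :: "'w measure" +
  fixes d :: "nat \<Rightarrow> real" and Z :: "nat \<Rightarrow> 'w \<Rightarrow> real" and T :: nat
    and D \<mu> g G A C R v E :: real
  assumes d: "\<And>s. s \<in> {1..T} \<Longrightarrow> \<bar>d s\<bar> \<le> D"
    and \<mu>: "0 < \<mu>"
    and excited: "\<And>t x y. t \<le> T \<Longrightarrow> \<mu> * (real (Suc t))\<^sup>2 * (x\<^sup>2 + y\<^sup>2) \<le> qform d t x y"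
    and gain: "2 \<le> g * G" "g * G \<le> R"
    and indep: "indep_vars (\<lambda>_. borel) Z {1..T}"
    and Z: "\<And>s. s \<in> {1..T} \<Longrightarrow> sq_integrable M (Z s)"
      "\<And>s. s \<in> {1..T} \<Longrightarrow> expectation (Z s) = 0"
      "\<And>s. s \<in> {1..T} \<Longrightarrow> expectation (\<lambda>\<omega>. (Z s \<omega>)\<^sup>2) \<le> v"
    and init: "A\<^sup>2 + C\<^sup>2 \<le> E"
begin

text \<open>An index \<open>t\<close> counts completed slots: \<open>estim t\<close> has absorbed
  the noise of slots 1 to \<open>t\<close>, while \<open>pred_err t\<close>,
  \<open>perturb t\<close> and \<open>price_err t\<close> concern the price posted in slot
  \<open>Suc t\<close>.\<close>

definition estim :: "nat \<Rightarrow> 'w \<Rightarrow> real \<times> real" where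
  "estim t \<omega> = est d g G A C (\<lambda>s. Z s \<omega>) t"

definition err1 :: "nat \<Rightarrow> 'w \<Rightarrow> real" where
  "err1 t \<omega> = fst (estim t \<omega>) - A"

definition err2 :: "nat \<Rightarrow> 'w \<Rightarrow> real" where
  "err2 t \<omega> = snd (estim t \<omega>) - C"

definition pred_err :: "nat \<Rightarrow> 'w \<Rightarrow> real" where
  "pred_err t \<omega> = err1 t \<omega> * d (Suc t) + err2 t \<omega>"

definition perturb :: "nat \<Rightarrow> 'w \<Rightarrow> real" where
  "perturb t \<omega> = (safe_slope (Suc t) (fst (estim t \<omega>)) - fst (estim t \<omega>)) * d (Suc t)"

definition price_err :: "nat \<Rightarrow> 'w \<Rightarrow> real" where
  "price_err t \<omega> = safe_slope (Suc t) (fst (estim t \<omega>)) * d (Suc t) + snd (estim t \<omega>)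
     - (A * d (Suc t) + C)"

lemma price_err_eq: "price_err t \<omega> = pred_err t \<omega> + perturb t \<omega>"
  by (simp add: price_err_def pred_err_def perturb_def err1_def err2_def algebra_simps)

definition correction :: "nat \<Rightarrow> 'w \<Rightarrow> real" where
  "correction t \<omega> = real (Suc t) * (g * G * price_err t \<omega> + g * Z (Suc t) \<omega>)"

lemma err_Suc:
  "err1 (Suc t) \<omega> = err1 t \<omega> - correction t \<omega> * gain1 d (Suc t)"
  "err2 (Suc t) \<omega> = err2 t \<omega> - correction t \<omega> * gain2 d (Suc t)"
  by (simp_all add: err1_def err2_def estim_def correction_def price_err_def Let_def
      case_prod_beta' algebra_simps)

lemma estim_eq_restrict: "estim t \<omega> = est d g G A C (\<lambda>s\<in>{1..t}. Z s \<omega>) t"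
  unfolding estim_def by (rule est_cong) simp

lemma estim_measurable:
  assumes "t \<le> T"
  shows "(\<lambda>\<omega>. estim t \<omega>) \<in> borel_measurable M"
proof -
  have "(\<lambda>\<omega>. \<lambda>s\<in>{1..t}. Z s \<omega>) \<in> measurable M (Pi\<^sub>M {1..t} (\<lambda>_. borel))"
    using assms by (intro measurable_restrict sq_integrable_measurable Z(1)) auto
  from measurable_compose[OF this est_measurable[OF order_refl]] show ?thesis
    unfolding estim_eq_restrict .
qed

text \<open>The estimate is a function of \<open>Z 1\<close>, ..., \<open>Z t\<close>, hence
  independent of the centred \<open>Z (Suc t)\<close>, and the expectation of the product
  factorizes.\<close>

lemma cross_term:
  assumes t: "t < T" and f: "f \<in> borel_measurable borel"
    and int: "integrable M (\<lambda>\<omega>. f (estim t \<omega>))"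
  shows "integrable M (\<lambda>\<omega>. f (estim t \<omega>) * Z (Suc t) \<omega>)"
    and "expectation (\<lambda>\<omega>. f (estim t \<omega>) * Z (Suc t) \<omega>) = 0"
proof -
  have "indep_var (Pi\<^sub>M {1..t} (\<lambda>_. borel)) (\<lambda>\<omega>. \<lambda>s\<in>{1..t}. Z s \<omega>)
      (Pi\<^sub>M {Suc t} (\<lambda>_. borel)) (\<lambda>\<omega>. \<lambda>s\<in>{Suc t}. Z s \<omega>)"
    using t by (intro indep_var_restrict[OF indep]) auto
  then have "indep_var borel ((\<lambda>z. f (est d g G A C z t)) \<circ> (\<lambda>\<omega>. \<lambda>s\<in>{1..t}. Z s \<omega>))
      borel ((\<lambda>z. z (Suc t)) \<circ> (\<lambda>\<omega>. \<lambda>s\<in>{Suc t}. Z s \<omega>))"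
    by (rule indep_var_compose)
      (rule measurable_compose[OF est_measurable[OF order_refl] f], rule measurable_component_singleton, simp)
  then have ind: "indep_var borel (\<lambda>\<omega>. f (estim t \<omega>)) borel (Z (Suc t))"
    by (simp add: comp_def estim_eq_restrict)
  have "sq_integrable M (Z (Suc t))"
    using t by (intro Z(1)) auto
  then have intZ: "integrable M (Z (Suc t))"
    by (auto simp: sq_integrable_def intro: square_integrable_imp_integrable)
  show "integrable M (\<lambda>\<omega>. f (estim t \<omega>) * Z (Suc t) \<omega>)"
    by (rule indep_var_integrable[OF ind int intZ])
  show "expectation (\<lambda>\<omega>. f (estim t \<omega>) * Z (Suc t) \<omega>) = 0"
    using indep_var_lebesgue_integral[OF ind int intZ] Z(2)[of "Suc t"] t by simp
qed

lemma safe_slope_diff_measurable: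
  assumes "t \<le> T"
  shows "(\<lambda>\<omega>. safe_slope n (fst (estim t \<omega>)) - fst (estim t \<omega>)) \<in> borel_measurable M"
proof -
  note estim_measurable[OF assms, measurable]
  show ?thesis by measurable
qed

lemma perturb_sq_le:
  assumes "t < T"
  shows "(real (Suc t))\<^sup>2 * (perturb t \<omega>)\<^sup>2 \<le> 4 * D\<^sup>2"
proof -
  have "\<bar>real (Suc t) * perturb t \<omega>\<bar> = real (Suc t) *
      \<bar>safe_slope (Suc t) (fst (estim t \<omega>)) - fst (estim t \<omega>)\<bar> * \<bar>d (Suc t)\<bar>"
    by (simp add: perturb_def abs_mult)
  also have "\<dots> \<le> real (Suc t) * (2 / real (Suc t)) * D"
    using assms by (intro mult_mono mult_left_mono abs_safe_slope_diff_le d) auto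
  also have "\<dots> = 2 * D"
    by (simp del: of_nat_Suc)
  finally have "\<bar>real (Suc t) * perturb t \<omega>\<bar>\<^sup>2 \<le> (2 * D)\<^sup>2"
    by (intro power_mono) auto
  then show ?thesis
    by (simp add: power_mult_distrib)
qed

lemma perturb_sq_integrable:
  assumes "t < T"
  shows "sq_integrable M (perturb t)"
proof -
  have "sq_integrable M (\<lambda>\<omega>. d (Suc t) * (safe_slope (Suc t) (fst (estim t \<omega>)) - fst (estim t \<omega>)))"
    using assms abs_safe_slope_diff_le[of "Suc t"]
    by (intro sq_integrable_cmult sq_integrable_bounded[where b = "2 / real (Suc t)"]
        safe_slope_diff_measurable) auto
  then show ?thesis
    by (simp add: perturb_def [abs_def] mult.commute)
qed

lemma err_sq_integrable:
  "t \<le> T \<Longrightarrow> sq_integrable M (err1 t) \<and> sq_integrable M (err2 t)"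
proof (induction t)
  case 0
  show ?case
    by (simp add: err1_def [abs_def] err2_def [abs_def] estim_def sq_integrable_def)
next
  case (Suc t)
  then have IH: "sq_integrable M (err1 t)" "sq_integrable M (err2 t)"
    by simp_all
  have "sq_integrable M (\<lambda>\<omega>. d (Suc t) * err1 t \<omega> + err2 t \<omega> + perturb t \<omega>)"
    using Suc.prems by (intro sq_integrable_add sq_integrable_cmult IH perturb_sq_integrable) simp
  then have p: "sq_integrable M (price_err t)"
    by (simp add: price_err_eq [abs_def] pred_err_def mult.commute)
  have c: "sq_integrable M (correction t)"
    unfolding correction_def [abs_def] using Suc.prems
    by (intro sq_integrable_add sq_integrable_cmult p Z(1)) auto
  show ?case
    unfolding err_Suc [abs_def]
    using sq_integrable_diff[OF IH(1) sq_integrable_cmult[OF c, of "gain1 d (Suc t)"]]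
      sq_integrable_diff[OF IH(2) sq_integrable_cmult[OF c, of "gain2 d (Suc t)"]]
    by (simp add: mult.commute)
qed

lemma pred_err_sq_integrable:
  assumes "t \<le> T"
  shows "sq_integrable M (pred_err t)"
proof -
  have "sq_integrable M (\<lambda>\<omega>. d (Suc t) * err1 t \<omega> + err2 t \<omega>)"
    using err_sq_integrable[OF assms] by (intro sq_integrable_add sq_integrable_cmult) auto
  then show ?thesis
    by (simp add: pred_err_def [abs_def] mult.commute)
qed

lemma price_err_sq_integrable:
  "t < T \<Longrightarrow> sq_integrable M (price_err t)"
  unfolding price_err_eq [abs_def]
  by (intro sq_integrable_add pred_err_sq_integrable perturb_sq_integrable) auto

section \<open>The Lyapunov function and its drift\<close>

definition lyap :: "nat \<Rightarrow> 'w \<Rightarrow> real" where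
  "lyap t \<omega> = qform d t (err1 t \<omega>) (err2 t \<omega>)"

lemma lyap_integrable:
  assumes "t \<le> T"
  shows "integrable M (lyap t)"
proof -
  have e: "sq_integrable M (err1 t)" "sq_integrable M (err2 t)"
    using err_sq_integrable[OF assms] by auto
  have "integrable M (\<lambda>\<omega>. (1 + wmom d 2 t) * (err1 t \<omega>)\<^sup>2
      + 2 * wmom d 1 t * (err1 t \<omega> * err2 t \<omega>) + (1 + wmom d 0 t) * (err2 t \<omega>)\<^sup>2)"
    using e integrable_mult_of_sq_integrable[OF e]
    by (intro Bochner_Integration.integrable_add integrable_mult_right) (auto simp: sq_integrable_def)
  then show ?thesis
    by (simp add: lyap_def [abs_def] qform_eq_wmom mult.assoc)
qed

lemma price_err_cross_term:
  assumes "t < T"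
  shows "expectation (\<lambda>\<omega>. price_err t \<omega> * Z (Suc t) \<omega>) = 0"
    and "integrable M (\<lambda>\<omega>. price_err t \<omega> * Z (Suc t) \<omega>)"
proof -
  define f where "f u = safe_slope (Suc t) (fst u) * d (Suc t) + snd u - (A * d (Suc t) + C)"
    for u :: "real \<times> real"
  have f: "f \<in> borel_measurable borel"
    unfolding f_def [abs_def] by measurable
  have p: "price_err t = (\<lambda>\<omega>. f (estim t \<omega>))"
    by (simp add: fun_eq_iff price_err_def f_def)
  have "integrable M (price_err t)"
    using price_err_sq_integrable[OF assms]
    by (auto simp: sq_integrable_def intro: square_integrable_imp_integrable)
  with cross_term[OF assms f] show "expectation (\<lambda>\<omega>. price_err t \<omega> * Z (Suc t) \<omega>) = 0"
    "integrable M (\<lambda>\<omega>. price_err t \<omega> * Z (Suc t) \<omega>)"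
    unfolding p by auto
qed

definition H :: real where "H = (1 + D\<^sup>2) / \<mu>"

lemma d_sq_le: "t < T \<Longrightarrow> (d (Suc t))\<^sup>2 \<le> D\<^sup>2"
  using d[of "Suc t"] by (simp add: abs_le_square_iff[symmetric])

lemma weighted_leverage_le:
  assumes "t < T"
  shows "(real (Suc t))\<^sup>2 * leverage d (Suc t) \<le> H"
proof -
  have "leverage d (Suc t) \<le> (1 + (d (Suc t))\<^sup>2) / (\<mu> * (real (Suc t))\<^sup>2)"
  proof (rule leverage_le)
    fix x y
    have "\<mu> * (real (Suc t))\<^sup>2 * (x\<^sup>2 + y\<^sup>2) \<le> \<mu> * (real (Suc (Suc t)))\<^sup>2 * (x\<^sup>2 + y\<^sup>2)"
      using \<mu> by (intro mult_right_mono mult_left_mono power_mono) auto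
    also have "\<dots> \<le> qform d (Suc t) x y"
      using assms by (intro excited) simp
    finally show "\<mu> * (real (Suc t))\<^sup>2 * (x\<^sup>2 + y\<^sup>2) \<le> qform d (Suc t) x y" .
  qed (use \<mu> in simp)
  also have "\<dots> \<le> (1 + D\<^sup>2) / (\<mu> * (real (Suc t))\<^sup>2)"
    using d_sq_le[OF assms] \<mu> by (intro divide_right_mono) auto
  finally show ?thesis
    using \<mu> by (simp add: H_def field_simps del: of_nat_Suc)
qed

text \<open>The first bound uses only the identity in \<open>M\<^sub>t\<close> and turns the
  leftover q^2 of the early slots into a multiple of the Lyapunov function. The second uses the
  quadratic growth of \<open>M\<^sub>t\<close> and provides the final rate.\<close>

lemma pred_err_sq_le:
  assumes "t < T"
  shows "(pred_err t \<omega>)\<^sup>2 \<le> (1 + D\<^sup>2) * lyap t \<omega>"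
    and "(real (Suc t))\<^sup>2 * (pred_err t \<omega>)\<^sup>2 \<le> H * lyap t \<omega>"
proof -
  define e where "e = (err1 t \<omega>)\<^sup>2 + (err2 t \<omega>)\<^sup>2"
  have "(pred_err t \<omega>)\<^sup>2 \<le> (1 + (d (Suc t))\<^sup>2) * e"
    unfolding pred_err_def e_def by (rule linear_form_sq_le)
  also have "\<dots> \<le> (1 + D\<^sup>2) * e"
    using d_sq_le[OF assms] by (intro mult_right_mono) (auto simp: e_def)
  finally have *: "(pred_err t \<omega>)\<^sup>2 \<le> (1 + D\<^sup>2) * e" .
  also have "\<dots> \<le> (1 + D\<^sup>2) * lyap t \<omega>"
    unfolding e_def lyap_def by (intro mult_left_mono qform_ge_norm) auto
  finally show "(pred_err t \<omega>)\<^sup>2 \<le> (1 + D\<^sup>2) * lyap t \<omega>" .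
  have "(real (Suc t))\<^sup>2 * (pred_err t \<omega>)\<^sup>2 \<le> (real (Suc t))\<^sup>2 * ((1 + D\<^sup>2) * e)"
    using * by (intro mult_left_mono) auto
  also have "\<dots> = H * (\<mu> * (real (Suc t))\<^sup>2 * e)"
    using \<mu> by (simp add: H_def)
  also have "\<dots> \<le> H * lyap t \<omega>"
    unfolding e_def lyap_def using assms \<mu> by (intro mult_left_mono excited) (auto simp: H_def)
  finally show "(real (Suc t))\<^sup>2 * (pred_err t \<omega>)\<^sup>2 \<le> H * lyap t \<omega>" .
qed

lemma R_ge: "2 \<le> R"
  using gain by linarith

lemma H_pos: "0 < H"
  using \<mu> by (simp add: H_def add_pos_nonneg)

text \<open>Relative growth per slot while the drift may still be positive, that is, below the
  threshold \<open>4 * R * H\<close> of \<open>drift_le\<close>.\<close>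

definition growth :: real where
  "growth = (4 * R * H + 2 * H * R\<^sup>2) * (1 + D\<^sup>2)"

text \<open>Additive contribution per slot: the first two terms come from the slope perturbation,
  through \<open>drift_le\<close> with b = 4 D^2, the last from the noise.\<close>

definition increment :: real where
  "increment = 2 * R * (4 * D\<^sup>2) + 2 * H * R\<^sup>2 * (4 * D\<^sup>2) + H * (g\<^sup>2 * v)"

lemma growth_nonneg: "0 \<le> growth"
  using R_ge H_pos by (simp add: growth_def)

lemma expectation_lyap_Suc:
  assumes t: "t < T"
  shows "expectation (lyap (Suc t))
    \<le> (1 + (if real (Suc t) < 4 * R * H then growth else 0)) * expectation (lyap t) + increment"
proof -
  define w where "w = real (Suc t)"
  define \<rho> where "\<rho> = g * G"
  define h where "h = leverage d (Suc t)"
  define \<kappa> where "\<kappa> = (if w < 4 * R * H then growth else 0)"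
  define b where "b = 2 * R * (4 * D\<^sup>2) + 2 * H * R\<^sup>2 * (4 * D\<^sup>2)"
  \<comment> \<open>\<open>L\<close> collects the coefficient of the new noise. It is a function of
    the current estimate, so its product with the noise has mean zero.\<close>
  define L where "L \<omega> = - 2 * w * g * pred_err t \<omega> + 2 * w\<^sup>2 * h * \<rho> * g * price_err t \<omega>" for \<omega>
  have wh: "0 \<le> h" "w\<^sup>2 * h \<le> H"
    using weighted_leverage_le[OF t] leverage_nonneg by (auto simp: h_def w_def)
  have bound: "lyap (Suc t) \<omega>
      \<le> (1 + \<kappa>) * lyap t \<omega> + b + L \<omega> * Z (Suc t) \<omega> + w\<^sup>2 * h * (g\<^sup>2 * (Z (Suc t) \<omega>)\<^sup>2)" for \<omega>
  proof -
    define q p z k where "q = pred_err t \<omega>" and "p = perturb t \<omega>" and "z = Z (Suc t) \<omega>"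
      and "k = correction t \<omega>"
    have k: "k = w * (\<rho> * (q + p) + g * z)"
      by (simp add: k_def correction_def price_err_eq w_def \<rho>_def q_def p_def z_def)
    \<comment> \<open>Two stages: the new weight acts on the old error and adds
      \<open>w * q\<^sup>2\<close>; then the correction is applied in the form that already includes
      this weight.\<close>
    have "lyap (Suc t) \<omega> = lyap t \<omega> + w * q\<^sup>2 - 2 * k * q + k\<^sup>2 * h"
      unfolding lyap_def err_Suc qform_update qform_Suc[of d t "err1 t \<omega>"]
      by (simp add: q_def pred_err_def k_def h_def w_def)
    also have "\<dots> = lyap t \<omega>
        + (w * q\<^sup>2 - 2 * w * \<rho> * (q * (q + p)) + w\<^sup>2 * h * (\<rho> * (q + p))\<^sup>2)
        + L \<omega> * z + w\<^sup>2 * h * (g\<^sup>2 * z\<^sup>2)"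
      unfolding k L_def price_err_eq q_def[symmetric] p_def[symmetric]
      by (simp add: power2_eq_square algebra_simps)
    finally have 1: "lyap (Suc t) \<omega> = \<dots>" .
    have "w * q\<^sup>2 - 2 * w * \<rho> * (q * (q + p)) + w\<^sup>2 * h * (\<rho> * (q + p))\<^sup>2
        \<le> (if w < 4 * R * H then 4 * R * H + 2 * H * R\<^sup>2 else 0) * q\<^sup>2 + b"
      unfolding b_def using gain wh perturb_sq_le[OF t, of \<omega>]
      by (intro drift_le) (auto simp: w_def \<rho>_def p_def)
    also have "\<dots> \<le> (if w < 4 * R * H then 4 * R * H + 2 * H * R\<^sup>2 else 0)
        * ((1 + D\<^sup>2) * lyap t \<omega>) + b"
      using pred_err_sq_le(1)[OF t, of \<omega>] R_ge H_pos
      by (intro add_right_mono mult_left_mono) (auto simp: q_def)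
    also have "\<dots> = \<kappa> * lyap t \<omega> + b"
      by (simp add: \<kappa>_def growth_def)
    finally show ?thesis
      unfolding 1 z_def by (simp add: algebra_simps)
  qed
  have Zs: "sq_integrable M (Z (Suc t))"
    using t by (intro Z(1)) auto
  define f where "f u = - 2 * w * g * ((fst u - A) * d (Suc t) + (snd u - C))
      + 2 * w\<^sup>2 * h * \<rho> * g * (safe_slope (Suc t) (fst u) * d (Suc t) + snd u - (A * d (Suc t) + C))"
    for u :: "real \<times> real"
  have L: "L \<omega> = f (estim t \<omega>)" for \<omega>
    by (simp add: L_def f_def pred_err_def price_err_def err1_def err2_def)
  have f: "f \<in> borel_measurable borel"
    unfolding f_def [abs_def] by measurable
  have "sq_integrable M L"
    unfolding L_def [abs_def] using t
    by (intro sq_integrable_add sq_integrable_cmult pred_err_sq_integrable price_err_sq_integrable) auto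
  then have "integrable M L"
    by (auto simp: sq_integrable_def intro: square_integrable_imp_integrable)
  then have cross: "integrable M (\<lambda>\<omega>. L \<omega> * Z (Suc t) \<omega>)"
    "expectation (\<lambda>\<omega>. L \<omega> * Z (Suc t) \<omega>) = 0"
    unfolding L using cross_term[OF t f] by (simp_all add: L [abs_def])
  have int: "integrable M (lyap t)" "integrable M (lyap (Suc t))"
    "integrable M (\<lambda>\<omega>. (Z (Suc t) \<omega>)\<^sup>2)"
    using t Zs by (auto intro!: lyap_integrable simp: sq_integrable_def)
  have "expectation (lyap (Suc t)) \<le> expectation (\<lambda>\<omega>. (1 + \<kappa>) * lyap t \<omega> + b
      + L \<omega> * Z (Suc t) \<omega> + w\<^sup>2 * h * (g\<^sup>2 * (Z (Suc t) \<omega>)\<^sup>2))"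
    using int cross by (intro integral_mono bound) auto
  also have "\<dots> = (1 + \<kappa>) * expectation (lyap t) + b
      + w\<^sup>2 * h * (g\<^sup>2 * expectation (\<lambda>\<omega>. (Z (Suc t) \<omega>)\<^sup>2))"
    using int cross by (simp add: prob_space)
  also have "w\<^sup>2 * h * (g\<^sup>2 * expectation (\<lambda>\<omega>. (Z (Suc t) \<omega>)\<^sup>2)) \<le> H * (g\<^sup>2 * v)"
    using wh H_pos t by (intro mult_mono mult_left_mono Z(3)) auto
  finally show ?thesis
    by (simp add: \<kappa>_def w_def b_def increment_def)
qed

lemma v_nonneg: "0 < T \<Longrightarrow> 0 \<le> v"
proof -
  assume "0 < T"
  have "0 \<le> expectation (\<lambda>\<omega>. (Z 1 \<omega>)\<^sup>2)"
    by simp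
  also have "\<dots> \<le> v"
    using \<open>0 < T\<close> by (intro Z(3)) simp
  finally show ?thesis .
qed

text \<open>The factor \<open>1 + growth\<close> acts only in slots below \<open>4 * R * H\<close>,
  hence a bounded number of times; afterwards only \<open>increment\<close> accumulates and the mean
  grows linearly.\<close>

lemma expectation_lyap_le:
  assumes "t \<le> T"
  shows "expectation (lyap t)
    \<le> (1 + growth) ^ min t (nat \<lceil>4 * R * H\<rceil>) * (E + increment * real t)"
  using assms
proof (induction t)
  case 0
  show ?case
    using init by (simp add: lyap_def [abs_def] qform_def err1_def err2_def estim_def prob_space)
next
  case (Suc t)
  define n where "n = nat \<lceil>4 * R * H\<rceil>"
  define \<kappa> where "\<kappa> = (if real (Suc t) < 4 * R * H then growth else 0)"
  have inc: "0 \<le> increment"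
    using R_ge H_pos v_nonneg Suc.prems by (simp add: increment_def)
  have E: "0 \<le> E"
    using init by (meson order_trans sum_power2_ge_zero)
  have pow: "(1 + \<kappa>) * (1 + growth) ^ min t n \<le> (1 + growth) ^ min (Suc t) n"
  proof (cases "real (Suc t) < 4 * R * H")
    case True
    then have "Suc t \<le> n"
      unfolding n_def by linarith
    then show ?thesis
      using True by (simp add: \<kappa>_def min_def)
  next
    case False
    then show ?thesis
      using growth_nonneg by (simp add: \<kappa>_def del: of_nat_Suc) (intro power_increasing; simp)
  qed
  have "expectation (lyap (Suc t)) \<le> (1 + \<kappa>) * expectation (lyap t) + increment"
    unfolding \<kappa>_def using Suc.prems by (intro expectation_lyap_Suc) simp
  also have "\<dots> \<le> (1 + \<kappa>) * ((1 + growth) ^ min t n * (E + increment * real t)) + increment"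
    using Suc growth_nonneg by (intro add_right_mono mult_left_mono) (auto simp: n_def \<kappa>_def)
  also have "\<dots> = (1 + \<kappa>) * (1 + growth) ^ min t n * (E + increment * real t) + 1 * increment"
    by simp
  also have "\<dots> \<le> (1 + growth) ^ min (Suc t) n * (E + increment * real t)
      + (1 + growth) ^ min (Suc t) n * increment"
    using pow E inc growth_nonneg
    by (intro add_mono mult_right_mono) auto
  also have "\<dots> = (1 + growth) ^ min (Suc t) n * (E + increment * real (Suc t))"
    by (simp add: algebra_simps)
  finally show ?case
    by (simp add: n_def)
qed

definition mse_const :: real where
  "mse_const = 2 * (H * ((1 + growth) ^ nat \<lceil>4 * R * H\<rceil> * (E + increment))) + 8 * D\<^sup>2"

text \<open>With w = t + 1, w^2 times the squared price error is at most
  \<open>2 * H * lyap t \<omega> + 8 * D\<^sup>2\<close>, whose mean is linear in w; constants are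
  absorbed by w \<ge> 1. Division by w^2 leaves 1/w.\<close>

lemma mean_sq_price_err_le:
  assumes t: "t < T"
  shows "expectation (\<lambda>\<omega>. (price_err t \<omega>)\<^sup>2) \<le> mse_const / real (Suc t)"
proof -
  define w where "w = real (Suc t)"
  define n where "n = nat \<lceil>4 * R * H\<rceil>"
  have w: "1 \<le> w"
    by (simp add: w_def)
  have inc: "0 \<le> increment"
    using R_ge H_pos v_nonneg t by (simp add: increment_def)
  have E: "0 \<le> E"
    using init by (meson order_trans sum_power2_ge_zero)
  have "w\<^sup>2 * (price_err t \<omega>)\<^sup>2 \<le> 2 * H * lyap t \<omega> + 8 * D\<^sup>2" for \<omega>
  proof -
    have "(price_err t \<omega>)\<^sup>2 \<le> 2 * (pred_err t \<omega>)\<^sup>2 + 2 * (perturb t \<omega>)\<^sup>2"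
      unfolding price_err_eq using zero_le_power2[of "pred_err t \<omega> - perturb t \<omega>"]
      by (simp add: power2_eq_square algebra_simps)
    then have "w\<^sup>2 * (price_err t \<omega>)\<^sup>2 \<le> w\<^sup>2 * (2 * (pred_err t \<omega>)\<^sup>2 + 2 * (perturb t \<omega>)\<^sup>2)"
      by (intro mult_left_mono) auto
    then show ?thesis
      using pred_err_sq_le(2)[OF t, of \<omega>] perturb_sq_le[OF t, of \<omega>]
      by (simp add: algebra_simps w_def[symmetric] del: of_nat_Suc)
  qed
  then have "expectation (\<lambda>\<omega>. w\<^sup>2 * (price_err t \<omega>)\<^sup>2) \<le> expectation (\<lambda>\<omega>. 2 * H * lyap t \<omega> + 8 * D\<^sup>2)"
    using price_err_sq_integrable[OF t] lyap_integrable[of t] t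
    by (intro integral_mono) (auto simp: sq_integrable_def)
  also have "\<dots> = 2 * (H * expectation (lyap t)) + 8 * D\<^sup>2"
    using lyap_integrable[of t] t by (simp add: prob_space)
  also have "\<dots> \<le> 2 * (H * ((1 + growth) ^ n * (E * w + increment * w))) + 8 * D\<^sup>2 * w"
  proof (intro add_mono mult_left_mono)
    have "expectation (lyap t) \<le> (1 + growth) ^ min t n * (E + increment * real t)"
      unfolding n_def using t by (intro expectation_lyap_le) simp
    also have "\<dots> \<le> (1 + growth) ^ n * (E * w + increment * w)"
    proof (intro mult_mono add_mono)
      show "E \<le> E * w"
        using mult_left_mono[OF w E] by simp
    qed (use inc E growth_nonneg in \<open>auto simp: w_def intro!: power_increasing mult_left_mono\<close>)
    finally show "expectation (lyap t) \<le> (1 + growth) ^ n * (E * w + increment * w)" .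
    show "8 * D\<^sup>2 \<le> 8 * D\<^sup>2 * w"
      using mult_left_mono[OF w, of "8 * D\<^sup>2"] by simp
  qed (use H_pos in auto)
  also have "\<dots> = mse_const * w"
    by (simp add: mse_const_def n_def algebra_simps)
  finally have "w * (w * expectation (\<lambda>\<omega>. (price_err t \<omega>)\<^sup>2)) \<le> w * mse_const"
    by (simp add: power2_eq_square algebra_simps)
  then show ?thesis
    using w by (simp add: w_def[symmetric] field_simps del: of_nat_Suc)
qed

end

section \<open>The policy\<close>

text \<open>Number of processed slots, estimated slope, estimated intercept, and the three entries
  of \<open>M\<^sub>t\<close>: both diagonal entries start at 1, the off-diagonal one, in between,
  at 0.\<close>

type_synonym estimator = "nat \<times> real \<times> real \<times> real \<times> real \<times> real"

fun estimator_step :: "nat \<Rightarrow> real \<Rightarrow> estimator \<Rightarrow> real \<times> real list \<Rightarrow> estimator" where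
  "estimator_step N Y (n, a, c, u, v, w) (lam, xs) =
     (let t = Suc n;
          d = (lam - c) / safe_slope t a;
          u' = u + real t * d\<^sup>2;
          v' = v + real t * d;
          w' = w + real t;
          k = real t * (2 / real N) * (real N * lam + sum_list xs - Y * d)
      in (t, a - k * ((w' * d - v') / (u' * w' - v'\<^sup>2)),
          c - k * ((u' - v' * d) / (u' * w' - v'\<^sup>2)), u', v', w'))"

text \<open>The factor \<open>2 / N\<close> relies on \<open>N\<close> being a known lower bound of the slope \<open>G = N (1 + \<Sum> 1/\<beta>\<^sub>i)\<close>.\<close>

definition newton_policy :: policy where
  "newton_policy N h Y d =
     (case foldl (estimator_step N Y) (0, 0, 0, 1, 0, 1) h of
        (n, a, c, _) \<Rightarrow> safe_slope (Suc n) a * d + c)"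

section \<open>Identification of the policy with the abstract recursion\<close>

definition residual_gain :: "dr_problem \<Rightarrow> real" where
  "residual_gain P = real (users P) * (1 + sum_inv_beta P)"

definition opt_slope :: "dr_problem \<Rightarrow> real" where
  "opt_slope P = opt_capacity P / residual_gain P"

definition opt_intercept :: "dr_problem \<Rightarrow> real" where
  "opt_intercept P = sum_alpha_beta P / residual_gain P"

lemma opt_price_eq: "opt_price P t = opt_slope P * target P t + opt_intercept P"
  by (simp add: opt_price_def opt_slope_def opt_intercept_def residual_gain_def sum_inv_beta_def
      add_divide_distrib distrib_left sum_distrib_left)

lemma sum_noisy_response:
  "(\<Sum>i=1..users P. noisy_response P e lam i)
     = real (users P) * sum_inv_beta P * lam - sum_alpha_beta P + (\<Sum>i=1..users P. e i)"
  by (simp add: noisy_response_def sum.distrib sum_subtractf diff_divide_distrib sum_inv_beta_def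
      sum_alpha_beta_def sum_distrib_left sum_distrib_right mult.commute)

text \<open>The aggregate response is affine in the price, and the optimal price is the zero of the
  noiseless residual; hence the unknown parameters survive only in the slope and in that
  zero.\<close>

lemma residual_eq:
  assumes "residual_gain P \<noteq> 0"
  shows "real (users P) * lam + (\<Sum>i=1..users P. noisy_response P e lam i) - opt_capacity P * d
    = residual_gain P * (lam - (opt_slope P * d + opt_intercept P)) + (\<Sum>i=1..users P. e i)"
proof -
  have "residual_gain P * (lam - (opt_slope P * d + opt_intercept P))
      = residual_gain P * lam - opt_capacity P * d - sum_alpha_beta P"
    using assms by (simp add: opt_slope_def opt_intercept_def algebra_simps)
  then show ?thesis
    unfolding sum_noisy_response by (simp add: residual_gain_def algebra_simps)
qed

definition problem_est :: "dr_problem \<Rightarrow> (nat \<Rightarrow> real) \<Rightarrow> nat \<Rightarrow> real \<times> real" where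
  "problem_est P = est (target P) (2 / real (users P)) (residual_gain P) (opt_slope P) (opt_intercept P)"

lemma estimator_history:
  assumes "residual_gain P \<noteq> 0"
  shows "foldl (estimator_step (users P) (opt_capacity P)) (0, 0, 0, 1, 0, 1)
      (online_history newton_policy P e t)
    = (t, fst (problem_est P (\<lambda>s. \<Sum>i=1..users P. e i s) t),
        snd (problem_est P (\<lambda>s. \<Sum>i=1..users P. e i s) t),
        1 + wmom (target P) 2 t, wmom (target P) 1 t, 1 + wmom (target P) 0 t)"
    (is "foldl ?step ?init _ = _")
proof (induction t)
  case 0
  show ?case
    by (simp add: problem_est_def wmom_def)
next
  case (Suc t)
  define h where "h = online_history newton_policy P e t"
  define d where "d = target P (Suc t)"
  define a where "a = fst (problem_est P (\<lambda>s. \<Sum>i=1..users P. e i s) t)"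
  define c where "c = snd (problem_est P (\<lambda>s. \<Sum>i=1..users P. e i s) t)"
  define lam where "lam = safe_slope (Suc t) a * d + c"
  define xs where "xs = map (noisy_response P (\<lambda>i. e i (Suc t)) lam) [1..<Suc (users P)]"
  have fold: "foldl ?step ?init h
      = (t, a, c, 1 + wmom (target P) 2 t, wmom (target P) 1 t, 1 + wmom (target P) 0 t)"
    using Suc by (simp add: h_def a_def c_def)
  have "newton_policy (users P) h (opt_capacity P) d = lam"
    by (simp add: newton_policy_def fold lam_def)
  then have hist: "online_history newton_policy P e (Suc t) = h @ [(lam, xs)]"
    by (simp add: h_def[symmetric] d_def[symmetric] xs_def Let_def del: upt_Suc)
  \<comment> \<open>The slope is nonzero by construction, so inverting the price rule recovers the
    past target exactly.\<close>
  have d: "(lam - c) / safe_slope (Suc t) a = d"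
    using safe_slope_nonzero[of "Suc t" a] by (simp add: lam_def)
  have "sum_list xs = (\<Sum>i=1..users P. noisy_response P (\<lambda>i. e i (Suc t)) lam i)"
    unfolding xs_def interv_sum_list_conv_sum_set_nat
    by (simp add: atLeastLessThanSuc_atLeastAtMost del: upt_Suc)
  then have r: "real (users P) * lam + sum_list xs - opt_capacity P * d
      = residual_gain P * (lam - (opt_slope P * d + opt_intercept P)) + (\<Sum>i=1..users P. e i (Suc t))"
    using residual_eq[OF assms, of lam "\<lambda>i. e i (Suc t)" d] by simp
  have m: "1 + wmom (target P) 2 t + real (Suc t) * d\<^sup>2 = 1 + wmom (target P) 2 (Suc t)"
    "wmom (target P) 1 t + real (Suc t) * d = wmom (target P) 1 (Suc t)"
    "1 + wmom (target P) 0 t + real (Suc t) = 1 + wmom (target P) 0 (Suc t)"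
    by (simp_all add: wmom_def d_def)
  define k where "k = real (Suc t) * (2 / real (users P))
    * (residual_gain P * (lam - (opt_slope P * d + opt_intercept P)) + (\<Sum>i=1..users P. e i (Suc t)))"
  have step: "?step (t, a, c, 1 + wmom (target P) 2 t, wmom (target P) 1 t, 1 + wmom (target P) 0 t) (lam, xs)
      = (Suc t, a - k * gain1 (target P) (Suc t), c - k * gain2 (target P) (Suc t),
         1 + wmom (target P) 2 (Suc t), wmom (target P) 1 (Suc t), 1 + wmom (target P) 0 (Suc t))"
    unfolding estimator_step.simps Let_def d m r k_def gain1_def gain2_def wdet_def d_def[symmetric]
    by simp
  have est: "problem_est P (\<lambda>s. \<Sum>i=1..users P. e i s) (Suc t)
      = (a - k * gain1 (target P) (Suc t), c - k * gain2 (target P) (Suc t))"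
    unfolding problem_est_def est.simps Let_def case_prod_beta'
    by (simp add: problem_est_def[symmetric] a_def c_def k_def lam_def d_def del: of_nat_Suc)
  show ?case
    unfolding hist foldl_append fold foldl.simps step est by simp
qed

lemma online_price_newton:
  assumes "residual_gain P \<noteq> 0"
  shows "online_price newton_policy P e (Suc t)
    = safe_slope (Suc t) (fst (problem_est P (\<lambda>s. \<Sum>i=1..users P. e i s) t)) * target P (Suc t)
      + snd (problem_est P (\<lambda>s. \<Sum>i=1..users P. e i s) t)"
  by (simp add: online_price_def newton_policy_def estimator_history[OF assms])

section \<open>The cost gap as a quadratic in the price error\<close>

text \<open>Completing the square in each user's cost removes \<alpha>, since x + \<alpha>/\<beta> =
  N \<lambda>/\<beta> + e. The last sum is free of the price and cancels when two prices are
  compared under the same noise.\<close>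

lemma slot_cost_noisy_response:
  assumes N: "0 < users P" and \<beta>: "\<And>i. i \<in> {1..users P} \<Longrightarrow> beta P i \<noteq> 0"
  shows "slot_cost P Y t (noisy_response P e lam)
    = real (users P) / 2 * sum_inv_beta P * lam\<^sup>2 + lam * (\<Sum>i=1..users P. e i)
      + (real (users P) * sum_inv_beta P * lam - sum_alpha_beta P + (\<Sum>i=1..users P. e i)
          - Y * target P t)\<^sup>2 / (2 * real (users P))
      + (\<Sum>i=1..users P. beta P i * (e i)\<^sup>2 / 2 - (alpha P i)\<^sup>2 / (2 * beta P i)) / real (users P)"
proof -
  define N where "N = real (users P)"
  have "1 / 2 * beta P i * (noisy_response P e lam i)\<^sup>2 + alpha P i * noisy_response P e lam i
      = 1 / beta P i * (N\<^sup>2 * lam\<^sup>2 / 2) + N * lam * e i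
        + (beta P i * (e i)\<^sup>2 / 2 - (alpha P i)\<^sup>2 / (2 * beta P i))" if "i \<in> {1..users P}" for i
    using \<beta>[OF that] by (simp add: noisy_response_def N_def field_simps power2_eq_square)
  then have "(\<Sum>i=1..users P. 1 / 2 * beta P i * (noisy_response P e lam i)\<^sup>2
        + alpha P i * noisy_response P e lam i)
      = sum_inv_beta P * (N\<^sup>2 * lam\<^sup>2 / 2) + N * lam * (\<Sum>i=1..users P. e i)
        + (\<Sum>i=1..users P. beta P i * (e i)\<^sup>2 / 2 - (alpha P i)\<^sup>2 / (2 * beta P i))"
    by (simp only: sum.distrib sum_distrib_left sum_distrib_right sum_inv_beta_def cong: sum.cong)
  moreover have "0 < N"
    using N by (simp add: N_def)
  ultimately show ?thesis
    unfolding slot_cost_def sum_noisy_response N_def[symmetric]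
    by (simp add: field_simps power2_eq_square)
qed

lemma slot_cost_diff_opt_price:
  assumes N: "0 < users P" and \<beta>: "\<And>i. i \<in> {1..users P} \<Longrightarrow> beta P i \<noteq> 0"
    and G: "residual_gain P \<noteq> 0"
  shows "slot_cost P (opt_capacity P) t (noisy_response P e lam)
      - slot_cost P (opt_capacity P) t (noisy_response P e (opt_price P t))
    = real (users P) / 2 * sum_inv_beta P * (1 + sum_inv_beta P) * (lam - opt_price P t)\<^sup>2
      + (1 + sum_inv_beta P) * ((lam - opt_price P t) * (\<Sum>i=1..users P. e i))"
proof -
  define n b a m z y where "n = real (users P)" and "b = sum_inv_beta P"
    and "a = sum_alpha_beta P" and "m = opt_price P t" and "z = (\<Sum>i=1..users P. e i)"
    and "y = opt_capacity P * target P t"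
  have n: "0 < n"
    using N by (simp add: n_def)
  \<comment> \<open>Optimality of \<open>m\<close> expressed as a formula for \<open>a\<close>;
    substituting it leaves no linear term in \<open>lam - m\<close> except the one multiplied by the
    noise.\<close>
  have a: "a = n * (1 + b) * m - y"
  proof -
    have "residual_gain P * m = y + a"
      using G by (simp add: m_def opt_price_eq opt_slope_def opt_intercept_def y_def a_def distrib_left)
    then show ?thesis
      by (simp add: residual_gain_def n_def b_def)
  qed
  have "n / 2 * b * lam\<^sup>2 + lam * z + (n * b * lam - a + z - y)\<^sup>2 / (2 * n)
      - (n / 2 * b * m\<^sup>2 + m * z + (n * b * m - a + z - y)\<^sup>2 / (2 * n))
      = n / 2 * b * (1 + b) * (lam - m)\<^sup>2 + (1 + b) * ((lam - m) * z)"
    unfolding a using n by (simp add: field_simps power2_eq_square)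
  moreover have "slot_cost P (opt_capacity P) t (noisy_response P e l)
      = n / 2 * b * l\<^sup>2 + l * z + (n * b * l - a + z - y)\<^sup>2 / (2 * n)
        + (\<Sum>i=1..users P. beta P i * (e i)\<^sup>2 / 2 - (alpha P i)\<^sup>2 / (2 * beta P i)) / n" for l
    unfolding n_def b_def a_def z_def y_def using N \<beta> by (rule slot_cost_noisy_response)
  ultimately have "slot_cost P (opt_capacity P) t (noisy_response P e lam)
      - slot_cost P (opt_capacity P) t (noisy_response P e m)
      = n / 2 * b * (1 + b) * (lam - m)\<^sup>2 + (1 + b) * ((lam - m) * z)"
    by simp
  then show ?thesis
    by (simp add: n_def b_def m_def z_def)
qed

section \<open>Noise, costs and regret\<close>

lemma (in prob_space) integrable_slot_cost:
  assumes e: "\<And>i. i \<in> {1..users P} \<Longrightarrow> sq_integrable M (e i)" and lam: "sq_integrable M lam"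
  shows "integrable M (\<lambda>\<omega>. slot_cost P Y t (noisy_response P (\<lambda>i. e i \<omega>) (lam \<omega>)))"
proof -
  have const: "sq_integrable M (\<lambda>_. c)" for c
    by (rule sq_integrable_bounded[where b = "\<bar>c\<bar>"]) auto
  have x: "sq_integrable M (\<lambda>\<omega>. noisy_response P (\<lambda>i. e i \<omega>) (lam \<omega>) i)" if "i \<in> {1..users P}" for i
  proof -
    have "sq_integrable M (\<lambda>\<omega>. real (users P) / beta P i * lam \<omega> - alpha P i / beta P i + e i \<omega>)"
      using that by (intro sq_integrable_add sq_integrable_diff sq_integrable_cmult const lam e)
    then show ?thesis
      by (simp add: noisy_response_def diff_divide_distrib)
  qed
  have x2: "integrable M (\<lambda>\<omega>. (noisy_response P (\<lambda>i. e i \<omega>) (lam \<omega>) i)\<^sup>2)"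
    "integrable M (\<lambda>\<omega>. noisy_response P (\<lambda>i. e i \<omega>) (lam \<omega>) i)" if "i \<in> {1..users P}" for i
    using x[OF that] by (auto simp: sq_integrable_def intro: square_integrable_imp_integrable)
  have "sq_integrable M (\<lambda>\<omega>. (\<Sum>i=1..users P. noisy_response P (\<lambda>i. e i \<omega>) (lam \<omega>) i) - Y * target P t)"
    by (intro sq_integrable_diff sq_integrable_sum const x)
  then have s2: "integrable M (\<lambda>\<omega>. ((\<Sum>i=1..users P. noisy_response P (\<lambda>i. e i \<omega>) (lam \<omega>) i) - Y * target P t)\<^sup>2)"
    by (simp add: sq_integrable_def)
  show ?thesis
    unfolding slot_cost_def
    by (intro Bochner_Integration.integrable_add integrable_mult_right Bochner_Integration.integrable_sum x2 s2)
qed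

lemma (in prob_space) std_normal_second_moment:
  assumes "distributed M lborel X (\<lambda>x. ennreal (std_normal_density x))"
  shows "sq_integrable M X" and "expectation (\<lambda>\<omega>. (X \<omega>)\<^sup>2) = 1"
proof -
  have "integrable M (\<lambda>\<omega>. (X \<omega>)\<^sup>2)"
    using distributed_integrable[OF assms, of "\<lambda>x. x\<^sup>2"] integrable_std_normal_moment[of 2] by simp
  then show "sq_integrable M X"
    using distributed_measurable[OF assms] by (simp add: sq_integrable_def)
  show "expectation (\<lambda>\<omega>. (X \<omega>)\<^sup>2) = 1"
    using distributed_integral[OF assms, of "\<lambda>x. x\<^sup>2"] integral_std_normal_moment_even[of 1] by simp
qed

lemma sum_inverse_le_one_plus_ln:
  assumes "0 < n"
  shows "(\<Sum>t=1..n. 1 / real t) \<le> 1 + ln (real n)"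
  using assms
proof (induction n rule: nat_induct_non_zero)
  case (Suc n)
  \<comment> \<open>Telescoping: ln x \<le> x - 1 at x = n / (n + 1) bounds each reciprocal by a
    difference of logarithms.\<close>
  have "ln (real n / real (Suc n)) \<le> real n / real (Suc n) - 1"
    using Suc by (intro ln_le_minus_one) auto
  also have "\<dots> = - (1 / real (Suc n))"
    by (simp add: field_simps)
  finally have "1 / real (Suc n) \<le> ln (real (Suc n)) - ln (real n)"
    using Suc by (simp add: ln_div del: of_nat_Suc)
  then show ?case
    using Suc by (simp del: of_nat_Suc)
qed simp

definition slot_noise :: "dr_problem \<Rightarrow> (nat \<Rightarrow> nat \<Rightarrow> 'w \<Rightarrow> real) \<Rightarrow> nat \<Rightarrow> 'w \<Rightarrow> real" where
  "slot_noise P \<epsilon> s \<omega> = (\<Sum>i=1..users P. \<epsilon> i s \<omega>)"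

text \<open>The index pairs split into disjoint blocks, one per slot; restrictions to disjoint
  blocks are independent, and each slot sum is a measurable function of its own block.\<close>

lemma indep_slot_noise:
  assumes "gaussian_noise M P \<epsilon>"
  shows "prob_space.indep_vars M (\<lambda>_. borel) (slot_noise P \<epsilon>) {1..horizon P}"
proof -
  interpret prob_space M
    using assms by (simp add: gaussian_noise_def)
  have "indep_vars (\<lambda>s. Pi\<^sub>M ({1..users P} \<times> {s}) (\<lambda>_. borel))
      (\<lambda>s \<omega>. \<lambda>j\<in>{1..users P} \<times> {s}. (case j of (i, t) \<Rightarrow> \<epsilon> i t) \<omega>) {1..horizon P}"
    using assms by (intro indep_vars_restrict[where I = "{1..users P} \<times> {1..horizon P}"])
      (auto simp: gaussian_noise_def disjoint_family_on_def)
  then have "indep_vars (\<lambda>_. borel)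
      (\<lambda>s \<omega>. \<Sum>i=1..users P. (\<lambda>j\<in>{1..users P} \<times> {s}. (case j of (i, t) \<Rightarrow> \<epsilon> i t) \<omega>) (i, s))
      {1..horizon P}"
    by (rule indep_vars_compose2)
      (auto intro!: borel_measurable_sum measurable_component_singleton)
  then show ?thesis
    by (rule indep_vars_cong[THEN iffD1, rotated 3]) (auto simp: slot_noise_def fun_eq_iff)
qed

lemma slot_noise_moments:
  assumes "gaussian_noise M P \<epsilon>" and s: "s \<in> {1..horizon P}"
  shows "sq_integrable M (slot_noise P \<epsilon> s)"
    and "(\<integral>\<omega>. slot_noise P \<epsilon> s \<omega> \<partial>M) = 0"
    and "(\<integral>\<omega>. (slot_noise P \<epsilon> s \<omega>)\<^sup>2 \<partial>M) \<le> (real (users P))\<^sup>2"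
proof -
  interpret prob_space M
    using assms by (simp add: gaussian_noise_def)
  have dist: "distributed M lborel (\<epsilon> i s) (\<lambda>x. ennreal (std_normal_density x))" if "i \<in> {1..users P}" for i
    using assms that by (simp add: gaussian_noise_def)
  have sq: "sq_integrable M (\<epsilon> i s)" if "i \<in> {1..users P}" for i
    by (rule std_normal_second_moment(1)[OF dist[OF that]])
  show 1: "sq_integrable M (slot_noise P \<epsilon> s)"
    unfolding slot_noise_def [abs_def] by (intro sq_integrable_sum sq)
  have int: "integrable M (\<epsilon> i s)" "expectation (\<epsilon> i s) = 0" if "i \<in> {1..users P}" for i
    using sq[OF that] standard_normal_distributed_expectation[OF dist[OF that]]
    by (auto simp: sq_integrable_def intro: square_integrable_imp_integrable)
  show "expectation (slot_noise P \<epsilon> s) = 0"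
    unfolding slot_noise_def [abs_def] using int by (subst Bochner_Integration.integral_sum) auto
  \<comment> \<open>Cauchy-Schwarz over the users gives N^2 where the exact variance is N; the final
    constant depends on N anyway.\<close>
  have "expectation (\<lambda>\<omega>. (slot_noise P \<epsilon> s \<omega>)\<^sup>2)
      \<le> expectation (\<lambda>\<omega>. real (users P) * (\<Sum>i=1..users P. (\<epsilon> i s \<omega>)\<^sup>2))"
  proof (rule integral_mono)
    show "integrable M (\<lambda>\<omega>. real (users P) * (\<Sum>i=1..users P. (\<epsilon> i s \<omega>)\<^sup>2))"
      using sq by (intro integrable_mult_right Bochner_Integration.integrable_sum)
        (simp add: sq_integrable_def)
    show "(slot_noise P \<epsilon> s \<omega>)\<^sup>2 \<le> real (users P) * (\<Sum>i=1..users P. (\<epsilon> i s \<omega>)\<^sup>2)" for \<omega>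
      using Cauchy_Schwarz_ineq_sum[of "\<lambda>_. 1" "\<lambda>i. \<epsilon> i s \<omega>" "{1..users P}"]
      by (simp add: slot_noise_def)
  qed (use 1 in \<open>simp add: sq_integrable_def\<close>)
  also have "\<dots> = real (users P) * (\<Sum>i=1..users P. expectation (\<lambda>\<omega>. (\<epsilon> i s \<omega>)\<^sup>2))"
    using sq by (subst Bochner_Integration.integral_mult_right, intro Bochner_Integration.integrable_sum)
      (auto simp: sq_integrable_def intro!: Bochner_Integration.integral_sum)
  also have "\<dots> = (real (users P))\<^sup>2"
    using std_normal_second_moment(2)[OF dist] by (simp add: power2_eq_square)
  finally show "expectation (\<lambda>\<omega>. (slot_noise P \<epsilon> s \<omega>)\<^sup>2) \<le> (real (users P))\<^sup>2" .
qed

section \<open>Uniform constants and the final bounds\<close>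

text \<open>Built from the regime and N alone, with b the largest possible value of
  \<open>sum_inv_beta\<close>. The absolute value and the summand 1 make it positive without
  inspecting \<open>mse_const\<close>.\<close>

definition gap_const :: "regime \<Rightarrow> nat \<Rightarrow> real" where
  "gap_const B N =
     (let b = real N / beta_lo B
      in real N / 2 * b * (1 + b)
           * \<bar>adaptive_pricing.mse_const (target_hi B)
               (excitation (target_hi B) (spread B) (spread_from B)) (2 / real N)
               (2 * (1 + b)) ((real N)\<^sup>2) ((capacity_hi B)\<^sup>2 + (alpha_hi B)\<^sup>2)\<bar> + 1)"

lemma gap_const_pos: "valid_regime B \<Longrightarrow> 0 < gap_const B N"
  by (auto simp: gap_const_def Let_def valid_regime_def intro!: add_nonneg_pos mult_nonneg_nonneg)

lemma beta_pos_if_standing: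
  assumes "standing_assumptions B P" "valid_regime B" "i \<in> {1..users P}"
  shows "0 < beta P i"
proof -
  have "beta_lo B \<le> beta P i"
    using assms unfolding standing_assumptions_def by blast
  then show ?thesis
    using assms(2) by (simp add: valid_regime_def)
qed

lemma sum_inv_beta_bounds:
  assumes "standing_assumptions B P" "valid_regime B"
  shows "0 \<le> sum_inv_beta P" "sum_inv_beta P \<le> real (users P) / beta_lo B"
    "\<bar>sum_alpha_beta P\<bar> \<le> alpha_hi B * sum_inv_beta P"
proof -
  have lo: "0 < beta_lo B" "0 \<le> alpha_hi B"
    using assms(2) by (auto simp: valid_regime_def)
  have \<beta>: "0 < beta P i" "beta_lo B \<le> beta P i" "\<bar>alpha P i\<bar> \<le> alpha_hi B"
    if "i \<in> {1..users P}" for i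
  proof -
    show "0 < beta P i" "beta_lo B \<le> beta P i"
      using assms that beta_pos_if_standing unfolding standing_assumptions_def by blast+
    have "\<bar>alpha P i\<bar> \<le> alpha_hi B \<or> alpha P i = 0"
      using assms(1) that unfolding standing_assumptions_def by blast
    then show "\<bar>alpha P i\<bar> \<le> alpha_hi B"
      using lo by auto
  qed
  show "0 \<le> sum_inv_beta P"
    unfolding sum_inv_beta_def using \<beta>(1) by (intro sum_nonneg) (simp add: less_imp_le)
  have "1 / beta P i \<le> 1 / beta_lo B" if "i \<in> {1..users P}" for i
    using \<beta>[OF that] lo by (intro divide_left_mono) auto
  then show "sum_inv_beta P \<le> real (users P) / beta_lo B"
    using sum_bounded_above[of "{1..users P}" "\<lambda>i. 1 / beta P i" "1 / beta_lo B"]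
    by (simp add: sum_inv_beta_def)
  have "\<bar>sum_alpha_beta P\<bar> \<le> (\<Sum>i=1..users P. \<bar>alpha P i / beta P i\<bar>)"
    unfolding sum_alpha_beta_def by (rule sum_abs)
  also have "\<dots> \<le> (\<Sum>i=1..users P. alpha_hi B * (1 / beta P i))"
  proof (rule sum_mono)
    fix i assume "i \<in> {1..users P}"
    from \<beta>[OF this] show "\<bar>alpha P i / beta P i\<bar> \<le> alpha_hi B * (1 / beta P i)"
      by (simp add: abs_divide divide_right_mono)
  qed
  also have "\<dots> = alpha_hi B * sum_inv_beta P"
    by (simp add: sum_inv_beta_def sum_distrib_left)
  finally show "\<bar>sum_alpha_beta P\<bar> \<le> alpha_hi B * sum_inv_beta P" .
qed

lemma newton_policy_gap:
  assumes N: "1 \<le> users P" and B: "valid_regime B" and P: "standing_assumptions B P"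
    and noise: "gaussian_noise M P \<epsilon>" and t: "t \<in> {1..horizon P}"
  shows "(\<lambda>\<omega>. online_price newton_policy P (\<lambda>i s. \<epsilon> i s \<omega>) t) \<in> borel_measurable M"
    and "integrable M (online_cost newton_policy P \<epsilon> t)"
    and "integrable M (offline_cost P \<epsilon> t)"
    and "gap M newton_policy P \<epsilon> t \<le> gap_const B (users P) * (1 / real t)"
proof -
  define N b where "N = real (users P)" and "b = sum_inv_beta P"
  define bh where "bh = N / beta_lo B"
  define D \<mu> where "D = target_hi B" and "\<mu> = excitation D (spread B) (spread_from B)"
  define E where "E = (capacity_hi B)\<^sup>2 + (alpha_hi B)\<^sup>2"
  have N1: "1 \<le> N"
    using N by (simp add: N_def)
  note bb = sum_inv_beta_bounds[OF P B, folded b_def N_def, folded bh_def]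
  have G: "residual_gain P = N * (1 + b)"
    by (simp add: residual_gain_def N_def b_def)
  have Gpos: "N \<le> residual_gain P" "0 < residual_gain P" "b \<le> residual_gain P"
    using N1 bb(1) mult_mono[of 1 N b b] by (auto simp: G distrib_left intro: add_pos_nonneg)
  \<comment> \<open>Both true coefficients are bounded independently of N: the capacity is at most
    \<open>capacity_hi B * N\<close>, the weighted sum of the \<alpha> at most
    \<open>alpha_hi B * b\<close>, and \<open>residual_gain P\<close> dominates both N and
    b.\<close>
  have slope: "0 \<le> opt_slope P" "opt_slope P \<le> capacity_hi B"
  proof -
    have Y: "0 \<le> opt_capacity P" "opt_capacity P \<le> capacity_hi B * N"
      using P B N1 by (auto simp: standing_assumptions_def valid_regime_def N_def
          intro: order_trans[of 0 "capacity_lo B * real (users P)"])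
    then show "0 \<le> opt_slope P"
      using Gpos by (simp add: opt_slope_def)
    have "capacity_hi B * N \<le> capacity_hi B * residual_gain P"
      using Gpos B by (intro mult_left_mono) (auto simp: valid_regime_def)
    with Y show "opt_slope P \<le> capacity_hi B"
      using Gpos by (simp add: opt_slope_def divide_le_eq)
  qed
  have \<alpha>: "0 \<le> alpha_hi B"
    using B by (auto simp: valid_regime_def)
  have "\<bar>opt_intercept P\<bar> \<le> alpha_hi B"
  proof -
    have "\<bar>sum_alpha_beta P\<bar> \<le> alpha_hi B * residual_gain P"
      using bb(3) mult_left_mono[OF Gpos(3) \<alpha>] by simp
    then show ?thesis
      using Gpos by (simp add: opt_intercept_def abs_divide divide_le_eq)
  qed
  then have init: "(opt_slope P)\<^sup>2 + (opt_intercept P)\<^sup>2 \<le> E"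
    unfolding E_def using slope \<alpha>
    by (intro add_mono) (auto simp: abs_le_square_iff[symmetric])
  interpret prob_space M
    using noise by (simp add: gaussian_noise_def)
  have sq_noise: "sq_integrable M (\<epsilon> i t)" if "i \<in> {1..users P}" for i
    using noise t that by (intro std_normal_second_moment(1)) (simp add: gaussian_noise_def)
  have d: "\<bar>target P s\<bar> \<le> D" if "s \<in> {1..horizon P}" for s
  proof -
    have "target_lo B \<le> target P s" "target P s \<le> target_hi B"
      using P that unfolding standing_assumptions_def by blast+
    moreover have "0 < target_lo B"
      using B by (simp add: valid_regime_def)
    ultimately show ?thesis
      by (simp add: D_def)
  qed
  \<comment> \<open>With g = 2 / N the product g G is exactly 2 (1 + b), which lies between 2 and 2
    (1 + bh).\<close>
  interpret ap: adaptive_pricing M "target P" "slot_noise P \<epsilon>" "horizon P" D \<mu> "2 / N"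
    "residual_gain P" "opt_slope P" "opt_intercept P" "2 * (1 + bh)" "N\<^sup>2" E
  proof
    show "0 < \<mu>"
      using B by (auto simp: \<mu>_def valid_regime_def intro!: excitation_pos)
    show "\<mu> * (real (Suc n))\<^sup>2 * (x\<^sup>2 + y\<^sup>2) \<le> qform (target P) n x y" if "n \<le> horizon P" for n x y
      unfolding \<mu>_def using that B P
      by (intro qform_ge_excitation d) (auto simp: valid_regime_def standing_assumptions_def)
    show "2 \<le> 2 / N * residual_gain P" "2 / N * residual_gain P \<le> 2 * (1 + bh)"
      using N1 bb by (auto simp: G)
  qed (use d init indep_slot_noise[OF noise] slot_noise_moments[OF noise] in \<open>auto simp: N_def\<close>)
  obtain n where n: "t = Suc n" "n < horizon P"
    using t by (cases t) auto
  have price: "online_price newton_policy P (\<lambda>i s. \<epsilon> i s \<omega>) t = opt_price P t + ap.price_err n \<omega>" for \<omega>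
    unfolding n(1) using Gpos
    by (subst online_price_newton)
      (auto simp: opt_price_eq ap.price_err_def ap.estim_def problem_est_def slot_noise_def N_def[symmetric])
  have const: "sq_integrable M (\<lambda>_. c)" for c
    by (rule sq_integrable_bounded[where b = "\<bar>c\<bar>"]) auto
  have pe: "sq_integrable M (ap.price_err n)"
    by (rule ap.price_err_sq_integrable[OF n(2)])
  have sq_price: "sq_integrable M (\<lambda>\<omega>. online_price newton_policy P (\<lambda>i s. \<epsilon> i s \<omega>) t)"
    unfolding price by (intro sq_integrable_add const pe)
  then show "(\<lambda>\<omega>. online_price newton_policy P (\<lambda>i s. \<epsilon> i s \<omega>) t) \<in> borel_measurable M"
    by (rule sq_integrable_measurable)
  show on: "integrable M (online_cost newton_policy P \<epsilon> t)"
    unfolding online_cost_def [abs_def] by (intro integrable_slot_cost sq_noise sq_price)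
  show off: "integrable M (offline_cost P \<epsilon> t)"
    unfolding offline_cost_def [abs_def] by (intro integrable_slot_cost sq_noise const)
  have \<beta>: "beta P i \<noteq> 0" if "i \<in> {1..users P}" for i
    using beta_pos_if_standing[OF P B that] by simp
  have diff: "online_cost newton_policy P \<epsilon> t \<omega> - offline_cost P \<epsilon> t \<omega>
      = N / 2 * b * (1 + b) * (ap.price_err n \<omega>)\<^sup>2
        + (1 + b) * (ap.price_err n \<omega> * slot_noise P \<epsilon> t \<omega>)" for \<omega>
    unfolding online_cost_def offline_cost_def price
    by (subst slot_cost_diff_opt_price) (use N \<beta> Gpos in \<open>auto simp: N_def b_def slot_noise_def\<close>)
  have "gap M newton_policy P \<epsilon> t
      = expectation (\<lambda>\<omega>. online_cost newton_policy P \<epsilon> t \<omega> - offline_cost P \<epsilon> t \<omega>)"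
    using on off by (simp add: gap_def)
  \<comment> \<open>The mixed term has mean zero: the price of slot \<open>t\<close> depends on
    earlier noise only.\<close>
  also have "\<dots> = N / 2 * b * (1 + b) * expectation (\<lambda>\<omega>. (ap.price_err n \<omega>)\<^sup>2)"
    unfolding diff using pe ap.price_err_cross_term[OF n(2)] by (simp add: sq_integrable_def n(1))
  also have "\<dots> \<le> N / 2 * bh * (1 + bh) * (\<bar>ap.mse_const\<bar> / real t)"
  proof (intro mult_mono)
    have "expectation (\<lambda>\<omega>. (ap.price_err n \<omega>)\<^sup>2) \<le> ap.mse_const / real t"
      using ap.mean_sq_price_err_le[OF n(2)] by (simp add: n(1))
    also have "\<dots> \<le> \<bar>ap.mse_const\<bar> / real t"
      by (intro divide_right_mono) auto
    finally show "expectation (\<lambda>\<omega>. (ap.price_err n \<omega>)\<^sup>2) \<le> \<bar>ap.mse_const\<bar> / real t" .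
  qed (use bb N1 in auto)
  also have "\<dots> \<le> gap_const B (users P) * (1 / real t)"
    unfolding gap_const_def Let_def N_def[symmetric] bh_def[symmetric] D_def[symmetric]
      \<mu>_def[symmetric] E_def[symmetric]
    by (simp add: algebra_simps add_divide_distrib)
  finally show "gap M newton_policy P \<epsilon> t \<le> gap_const B (users P) * (1 / real t)" .
qed

text \<open>For n \<ge> 2, ln 2 \<ge> 2/3 gives 1 \<le> 2 ln n, so 1 + ln n \<le> 3 ln n; this is
  the source of the factor 3.\<close>

lemma sum_le_ln_of_inverse_bound:
  fixes f :: "nat \<Rightarrow> real"
  assumes f: "\<And>t. t \<in> {1..n} \<Longrightarrow> f t \<le> K * (1 / real t)" and K: "0 \<le> K" and n: "2 \<le> n"
  shows "(\<Sum>t=1..n. f t) \<le> 3 * K * ln (real n)"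
proof -
  have "ln 2 \<le> ln (real n)"
    using n by simp
  then have ln: "1 \<le> 2 * ln (real n)"
    using ln2_ge_two_thirds by linarith
  have "(\<Sum>t=1..n. f t) \<le> (\<Sum>t=1..n. K * (1 / real t))"
    by (intro sum_mono f)
  also have "\<dots> = K * (\<Sum>t=1..n. 1 / real t)"
    by (rule sum_distrib_left[symmetric])
  also have "\<dots> \<le> K * (3 * ln (real n))"
    using sum_inverse_le_one_plus_ln[of n] n ln K by (intro mult_left_mono) auto
  finally show ?thesis
    by simp
qed

theorem theorem1:
  "\<exists>\<pi> :: policy. \<forall>N\<ge>1. \<forall>B. valid_regime B \<longrightarrow>
     (\<exists>K > 0. \<exists>n0 > 0. \<forall>P. \<forall>M :: 'w measure. \<forall>\<epsilon>.
        users P = N \<and> standing_assumptions B P \<and> gaussian_noise M P \<epsilon> \<longrightarrow>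
          (\<forall>t\<in>{1..horizon P}.
             (\<lambda>\<omega>. online_price \<pi> P (\<lambda>i s. \<epsilon> i s \<omega>) t) \<in> borel_measurable M \<and>
             integrable M (online_cost \<pi> P \<epsilon> t) \<and>
             integrable M (offline_cost P \<epsilon> t)) \<and>
          (\<forall>t\<in>{n0..horizon P}. gap M \<pi> P \<epsilon> t \<le> K * (1 / real t)) \<and>
          (n0 \<le> horizon P \<longrightarrow> regret M \<pi> P \<epsilon> \<le> K * ln (real (horizon P))))"
proof (intro exI[of _ newton_policy] allI impI, goal_cases)
  case (1 N B)
  have K: "0 < gap_const B N"
    using 1 by (intro gap_const_pos)
  show ?case
  \<comment> \<open>The threshold 2 keeps the logarithm of the horizon away from zero; the factor 3
    is needed for the regret and is merely slack for the single-slot gap.\<close>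
  proof (intro exI[of _ "3 * gap_const B N"] exI[of _ "2 :: nat"] conjI allI impI ballI; (elim conjE)?)
    fix P :: dr_problem and M :: "'w measure" and \<epsilon>
    assume P: "users P = N" "standing_assumptions B P" "gaussian_noise M P \<epsilon>"
    then have "1 \<le> users P"
      using 1 by simp
    note * = newton_policy_gap[OF this 1(2) P(2,3), unfolded P(1)]
    {
      fix t assume t: "t \<in> {1..horizon P}"
      show "(\<lambda>\<omega>. online_price newton_policy P (\<lambda>i s. \<epsilon> i s \<omega>) t) \<in> borel_measurable M"
        "integrable M (online_cost newton_policy P \<epsilon> t)" "integrable M (offline_cost P \<epsilon> t)"
        by (rule *[OF t])+
    }
    {
      fix t assume "t \<in> {2..horizon P}"
      then have "gap M newton_policy P \<epsilon> t \<le> gap_const B N * (1 / real t)"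
        by (intro *(4)) auto
      also have "\<dots> \<le> 3 * gap_const B N * (1 / real t)"
        using K by (intro mult_right_mono) auto
      finally show "gap M newton_policy P \<epsilon> t \<le> 3 * gap_const B N * (1 / real t)" .
    }
    show "regret M newton_policy P \<epsilon> \<le> 3 * gap_const B N * ln (real (horizon P))" if "2 \<le> horizon P"
      unfolding regret_def using K that by (intro sum_le_ln_of_inverse_bound *(4)) auto
  qed (use K in auto)
qed

end
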